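(* Let $n\ge 2$, let $K$ be a field, and let $L$ be the free Lie $K$-algebra with basis $\{a_1,\dots,a_n\}$. Then the field $(K;+,\cdot)$ is e-interpretable in $L$, and under this interpretation the action of $K$ on $L$ (i.e. the relation $\{(\alpha,x,z)\in K\times L\times L : z=\alpha x\}$) is also defined by a finite system of equations in $L$. Concretely, the set $A_0=\{(\alpha a_1,\dots,\alpha a_n)\mid \alpha\in K\}\subseteq L^n$ is definable by a finite system of equations in $L$ with coefficients $a_1,\dots,a_n$; the map $A_0\to K$, $(\alpha a_1,\dots,\alpha a_n)\mapsto\alpha$, is an e-interpretation of $K$ in $L$; and for $\bar y=(\alpha a_1,\dots,\alpha a_n)\in A_0$ and $x,z\in L$ one has $z=\alpha x$ if and only if $[z,a_i]=[x,y_i]$ for all $i=1,\dots,n$.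
   Context: $[\cdot,\cdot]$ denotes the Lie product in $L$. A subset $X\subseteq L^m$ is e-definable (Diophantine) in $L$ if there is a finite system of equations $\Sigma(x_1,\dots,x_m,y_1,\dots,y_k)$ with coefficients in $L$ such that $(c_1,\dots,c_m)\in X$ iff $\Sigma(c_1,\dots,c_m,y_1,\dots,y_k)$ has a solution in $L$. A map $\phi:X\subseteq L^m\to\mathcal A$ onto an algebraic structure $\mathcal A$ is an e-interpretation of $\mathcal A$ in $L$ if $X$ is e-definable in $L$, and the preimages under $\phi$ of the equality relation and of the graphs of all functions and predicates of $\mathcal A$ are e-definable in $L$. *)

theory Defs
  imports Complex_Main
begin

section \<open>Lie algebras over a field\<close>

locale lie_algebra = vector_space scale
  for scale :: "'k::field \<Rightarrow> 'l::ab_group_add \<Rightarrow> 'l" +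
  fixes bracket :: "'l \<Rightarrow> 'l \<Rightarrow> 'l"
  assumes bracket_add_left: "bracket (x + y) z = bracket x z + bracket y z"
    and bracket_add_right: "bracket x (y + z) = bracket x y + bracket x z"
    and bracket_scale_left: "bracket (scale c x) y = scale c (bracket x y)"
    and bracket_scale_right: "bracket x (scale c y) = scale c (bracket x y)"
    and bracket_self: "bracket x x = 0"
    and jacobi: "bracket x (bracket y z) + bracket y (bracket z x) + bracket z (bracket x y) = 0"

definition lie_hom ::
  "('k::field \<Rightarrow> 'l::ab_group_add \<Rightarrow> 'l) \<Rightarrow> ('l \<Rightarrow> 'l \<Rightarrow> 'l) \<Rightarrow>
   ('k \<Rightarrow> 'm::ab_group_add \<Rightarrow> 'm) \<Rightarrow> ('m \<Rightarrow> 'm \<Rightarrow> 'm) \<Rightarrow> ('l \<Rightarrow> 'm) \<Rightarrow> bool" where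
  "lie_hom s br s' br' h \<longleftrightarrow>
     Vector_Spaces.linear s s' h \<and> (\<forall>x y. h (br x y) = br' (h x) (h y))"

section \<open>The free Lie algebra on a type of generators\<close>

datatype ('x, 'k) lie_expr =
    LGen 'x
  | LZero
  | LAdd "('x, 'k) lie_expr" "('x, 'k) lie_expr"
  | LScale 'k "('x, 'k) lie_expr"
  | LBr "('x, 'k) lie_expr" "('x, 'k) lie_expr"

text \<open>The least congruence on formal expressions that contains all instances of the vector space
  and Lie algebra axioms.\<close>

inductive lie_eq :: "('x, 'k::field) lie_expr \<Rightarrow> ('x, 'k) lie_expr \<Rightarrow> bool" where
  lie_eq_refl: "lie_eq s s"
| lie_eq_sym: "lie_eq s t \<Longrightarrow> lie_eq t s"
| lie_eq_trans: "lie_eq s t \<Longrightarrow> lie_eq t u \<Longrightarrow> lie_eq s u"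
| lie_cong_add: "lie_eq s s' \<Longrightarrow> lie_eq t t' \<Longrightarrow> lie_eq (LAdd s t) (LAdd s' t')"
| lie_cong_scale: "lie_eq s s' \<Longrightarrow> lie_eq (LScale c s) (LScale c s')"
| lie_cong_br: "lie_eq s s' \<Longrightarrow> lie_eq t t' \<Longrightarrow> lie_eq (LBr s t) (LBr s' t')"
| lie_add_assoc: "lie_eq (LAdd (LAdd s t) u) (LAdd s (LAdd t u))"
| lie_add_comm: "lie_eq (LAdd s t) (LAdd t s)"
| lie_add_zero: "lie_eq (LAdd LZero s) s"
| lie_add_inverse: "lie_eq (LAdd (LScale (- 1) s) s) LZero"
| lie_scale_add: "lie_eq (LScale c (LAdd s t)) (LAdd (LScale c s) (LScale c t))"
| lie_add_scale: "lie_eq (LScale (c + d) s) (LAdd (LScale c s) (LScale d s))"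
| lie_scale_scale: "lie_eq (LScale c (LScale d s)) (LScale (c * d) s)"
| lie_scale_one: "lie_eq (LScale 1 s) s"
| lie_br_add_left: "lie_eq (LBr (LAdd s t) u) (LAdd (LBr s u) (LBr t u))"
| lie_br_add_right: "lie_eq (LBr s (LAdd t u)) (LAdd (LBr s t) (LBr s u))"
| lie_br_scale_left: "lie_eq (LBr (LScale c s) t) (LScale c (LBr s t))"
| lie_br_scale_right: "lie_eq (LBr s (LScale c t)) (LScale c (LBr s t))"
| lie_br_self: "lie_eq (LBr s s) LZero"
| lie_br_jacobi: "lie_eq (LAdd (LAdd (LBr s (LBr t u)) (LBr t (LBr u s))) (LBr u (LBr s t))) LZero"

quotient_type (overloaded) ('x, 'k) free_lie = "('x, 'k::field) lie_expr" / lie_eq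
  by (intro equivpI reflpI sympI transpI) (fact lie_eq_refl lie_eq_sym lie_eq_trans)+

instantiation free_lie :: (type, field) ab_group_add
begin

lift_definition zero_free_lie :: "('a, 'b) free_lie" is LZero .

lift_definition plus_free_lie ::
  "('a, 'b) free_lie \<Rightarrow> ('a, 'b) free_lie \<Rightarrow> ('a, 'b) free_lie" is LAdd
  by (rule lie_cong_add)

lift_definition uminus_free_lie :: "('a, 'b) free_lie \<Rightarrow> ('a, 'b) free_lie" is "LScale (- 1)"
  by (rule lie_cong_scale)

definition minus_free_lie :: "('a, 'b) free_lie \<Rightarrow> ('a, 'b) free_lie \<Rightarrow> ('a, 'b) free_lie" where
  "minus_free_lie x y = x + (- y)"

instance
proof
  fix x y z :: "('a, 'b) free_lie"
  show "x + y + z = x + (y + z)" by transfer (rule lie_add_assoc)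
  show "x + y = y + x" by transfer (rule lie_add_comm)
  show "0 + x = x" by transfer (rule lie_add_zero)
  show "- x + x = 0" by transfer (rule lie_add_inverse)
  show "x - y = x + - y" by (rule minus_free_lie_def)
qed

end

lift_definition fl_gen :: "'x \<Rightarrow> ('x, 'k::field) free_lie" is LGen .

lift_definition fl_scale :: "'k::field \<Rightarrow> ('x, 'k) free_lie \<Rightarrow> ('x, 'k) free_lie" is LScale
  by (rule lie_cong_scale)

lift_definition fl_bracket ::
  "('x, 'k::field) free_lie \<Rightarrow> ('x, 'k) free_lie \<Rightarrow> ('x, 'k) free_lie" is LBr
  by (rule lie_cong_br)

interpretation free_lie: lie_algebra fl_scale fl_bracket
  by unfold_locales
    (transfer, rule lie_scale_add lie_add_scale lie_scale_scale lie_scale_one lie_br_add_left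
      lie_br_add_right lie_br_scale_left lie_br_scale_right lie_br_self lie_br_jacobi)+

primrec (in lie_algebra) eval_expr :: "('x \<Rightarrow> 'l) \<Rightarrow> ('x, 'k) lie_expr \<Rightarrow> 'l" where
  "eval_expr g (LGen x) = g x"
| "eval_expr g LZero = 0"
| "eval_expr g (LAdd s t) = eval_expr g s + eval_expr g t"
| "eval_expr g (LScale c s) = scale c (eval_expr g s)"
| "eval_expr g (LBr s t) = bracket (eval_expr g s) (eval_expr g t)"

lemma (in lie_algebra) eval_expr_cong:
  "lie_eq s t \<Longrightarrow> eval_expr g s = eval_expr g t"
proof (induction rule: lie_eq.induct)
  case (lie_add_comm s t)
  then show ?case by (simp add: add.commute)
next
  case (lie_br_jacobi s t u)
  then show ?case by (simp add: jacobi)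
qed (simp_all add: bracket_add_left bracket_add_right bracket_scale_left bracket_scale_right
      bracket_self scale_right_distrib scale_left_distrib add.assoc)

text \<open>The universal property; the target Lie algebra lives on an arbitrary type.\<close>

theorem (in lie_algebra) free_lie_universal:
  "\<exists>!h. lie_hom fl_scale fl_bracket scale bracket h \<and> (\<forall>x. h (fl_gen x) = g x)"
proof -
  define h where "h v = eval_expr g (rep_free_lie v)" for v
  have h_abs: "h (abs_free_lie s) = eval_expr g s" for s
    unfolding h_def
    by (intro eval_expr_cong Quotient3_rep_abs[OF Quotient3_free_lie] lie_eq_refl)
  have h_add: "h (x + y) = h x + h y" for x y
    by (induct x rule: free_lie.abs_induct, induct y rule: free_lie.abs_induct)
      (simp add: plus_free_lie.abs_eq h_abs)
  have h_scale: "h (fl_scale c x) = scale c (h x)" for c x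
    by (induct x rule: free_lie.abs_induct) (simp add: fl_scale.abs_eq h_abs)
  have h_br: "h (fl_bracket x y) = bracket (h x) (h y)" for x y
    by (induct x rule: free_lie.abs_induct, induct y rule: free_lie.abs_induct)
      (simp add: fl_bracket.abs_eq h_abs)
  have h_gen: "h (fl_gen x) = g x" for x
    by (simp add: fl_gen.abs_eq h_abs)
  have "Vector_Spaces.linear fl_scale scale h"
    by unfold_locales (rule h_add h_scale)+
  then have hom: "lie_hom fl_scale fl_bracket scale bracket h"
    by (simp add: lie_hom_def h_br)
  have "k = h"
    if k: "lie_hom fl_scale fl_bracket scale bracket k" "\<forall>x. k (fl_gen x) = g x" for k
  proof -
    have lin: "Vector_Spaces.linear fl_scale scale k"
      and kbr: "\<And>x y. k (fl_bracket x y) = bracket (k x) (k y)"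
      using k(1) by (auto simp: lie_hom_def)
    interpret k: Vector_Spaces.linear fl_scale scale k by (rule lin)
    have "k (abs_free_lie s) = eval_expr g s" for s
    proof (induction s)
      case (LGen x)
      then show ?case using k(2) by (simp add: fl_gen.abs_eq)
    next
      case LZero
      then show ?case using k.zero by (simp add: zero_free_lie.abs_eq)
    next
      case (LAdd s t)
      then show ?case using k.add[of "abs_free_lie s" "abs_free_lie t"]
        by (simp add: plus_free_lie.abs_eq)
    next
      case (LScale c s)
      then show ?case using k.scale[of c "abs_free_lie s"] by (simp add: fl_scale.abs_eq)
    next
      case (LBr s t)
      then show ?case using kbr[of "abs_free_lie s" "abs_free_lie t"]
        by (simp add: fl_bracket.abs_eq)
    qed
    then have "k v = h v" for v
      by (induct v rule: free_lie.abs_induct) (simp add: h_abs)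
    then show ?thesis by (rule ext)
  qed
  with hom h_gen show ?thesis by blast
qed

section \<open>Systems of equations with coefficients\<close>

text \<open>Terms are in the one-sorted language of Lie rings with constants from \<open>L\<close>: there are no
  scalar multiplications, so the action of the field is not available for free.\<close>

datatype (coeffs: 'l) eq_term =
    Var nat
  | Coeff 'l
  | Zero
  | Add "'l eq_term" "'l eq_term"
  | Neg "'l eq_term"
  | Br "'l eq_term" "'l eq_term"

primrec vars :: "'l eq_term \<Rightarrow> nat set" where
  "vars (Var i) = {i}"
| "vars (Coeff c) = {}"
| "vars Zero = {}"
| "vars (Add s t) = vars s \<union> vars t"
| "vars (Neg s) = vars s"
| "vars (Br s t) = vars s \<union> vars t"

primrec eval_term ::
  "('l \<Rightarrow> 'l \<Rightarrow> 'l) \<Rightarrow> 'l list \<Rightarrow> 'l eq_term \<Rightarrow> 'l::ab_group_add" where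
  "eval_term br v (Var i) = v ! i"
| "eval_term br v (Coeff c) = c"
| "eval_term br v Zero = 0"
| "eval_term br v (Add s t) = eval_term br v s + eval_term br v t"
| "eval_term br v (Neg s) = - eval_term br v s"
| "eval_term br v (Br s t) = br (eval_term br v s) (eval_term br v t)"

type_synonym 'l eq_system = "('l eq_term \<times> 'l eq_term) set"

definition system_over :: "'l set \<Rightarrow> nat \<Rightarrow> 'l eq_system \<Rightarrow> bool" where
  "system_over C m \<Sigma> \<longleftrightarrow> finite \<Sigma> \<and>
     (\<forall>(s, t) \<in> \<Sigma>. coeffs s \<union> coeffs t \<subseteq> C \<and> vars s \<union> vars t \<subseteq> {..<m})"

definition solves :: "('l \<Rightarrow> 'l \<Rightarrow> 'l) \<Rightarrow> 'l::ab_group_add list \<Rightarrow> 'l eq_system \<Rightarrow> bool" where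
  "solves br v \<Sigma> \<longleftrightarrow> (\<forall>(s, t) \<in> \<Sigma>. eval_term br v s = eval_term br v t)"

text \<open>Subsets of \<open>L\<^sup>m\<close> are sets of lists of length \<open>m\<close>. In \<open>defined_by_system\<close> the set is the
  solution set itself; in \<open>e_definable\<close> it is the projection of one, with \<open>k\<close> auxiliary unknowns.\<close>

definition defined_by_system ::
  "('l::ab_group_add \<Rightarrow> 'l \<Rightarrow> 'l) \<Rightarrow> 'l set \<Rightarrow> nat \<Rightarrow> 'l list set \<Rightarrow> bool" where
  "defined_by_system br C m X \<longleftrightarrow>
     (\<exists>\<Sigma>. system_over C m \<Sigma> \<and> X = {v. length v = m \<and> solves br v \<Sigma>})"

definition e_definable ::
  "('l::ab_group_add \<Rightarrow> 'l \<Rightarrow> 'l) \<Rightarrow> nat \<Rightarrow> 'l list set \<Rightarrow> bool" where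
  "e_definable br m X \<longleftrightarrow>
     (\<exists>k \<Sigma>. system_over UNIV (m + k) \<Sigma> \<and>
        X = {v. length v = m \<and> (\<exists>y. length y = k \<and> solves br (v @ y) \<Sigma>)})"

text \<open>The interpreted structure has universe \<open>A\<close>, functions \<open>Fs\<close> and predicates \<open>Ps\<close>, each paired
  with its arity and taking its arguments as a list.\<close>

definition e_interpretation ::
  "('l::ab_group_add \<Rightarrow> 'l \<Rightarrow> 'l) \<Rightarrow> nat \<Rightarrow> 'l list set \<Rightarrow> ('l list \<Rightarrow> 'b) \<Rightarrow>
   'b set \<Rightarrow> (nat \<times> ('b list \<Rightarrow> 'b)) set \<Rightarrow> (nat \<times> ('b list \<Rightarrow> bool)) set \<Rightarrow> bool" where
  "e_interpretation br m X \<phi> A Fs Ps \<longleftrightarrow>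
     e_definable br m X \<and>
     \<phi> ` X = A \<and>
     e_definable br (2 * m) {u @ v | u v. u \<in> X \<and> v \<in> X \<and> \<phi> u = \<phi> v} \<and>
     (\<forall>(r, f) \<in> Fs. e_definable br (r * m + m)
        {concat us @ v | us v. length us = r \<and> set us \<subseteq> X \<and> v \<in> X \<and> \<phi> v = f (map \<phi> us)}) \<and>
     (\<forall>(r, P) \<in> Ps. e_definable br (r * m)
        {concat us | us. length us = r \<and> set us \<subseteq> X \<and> P (map \<phi> us)})"

definition field_functions :: "(nat \<times> ('k::field list \<Rightarrow> 'k)) set" where
  "field_functions = {(2, \<lambda>v. v ! 0 + v ! 1), (2, \<lambda>v. v ! 0 * v ! 1)}"

section \<open>The tuples of scalar multiples of a fixed tuple\<close>

definition scalar_tuple :: "('k \<Rightarrow> 'l \<Rightarrow> 'l) \<Rightarrow> 'l list \<Rightarrow> 'k \<Rightarrow> 'l list" where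
  "scalar_tuple s as \<alpha> = map (s \<alpha>) as"

definition scalar_of :: "('k \<Rightarrow> 'l \<Rightarrow> 'l) \<Rightarrow> 'l list \<Rightarrow> 'l list \<Rightarrow> 'k" where
  "scalar_of s as v = (THE \<alpha>. v = scalar_tuple s as \<alpha>)"

end

theory Submission
  imports Defs "HOL-Library.Function_Algebras" "HOL-Library.Product_Plus" "HOL-Library.Countable_Set"
begin

text \<open>Everything rests on the fact that the centralizer of a generator \<open>a\<close> is \<open>K a\<close>: then \<open>[y\<^sub>i, a\<^sub>i] = 0\<close>
  forces \<open>y\<^sub>i = \<alpha>\<^sub>i a\<^sub>i\<close>, the equations \<open>[y\<^sub>i, a\<^sub>j] = [a\<^sub>i, y\<^sub>j]\<close> make all \<open>\<alpha>\<^sub>i\<close> equal, and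
  \<open>[z - \<alpha> x, a\<^sub>i] = 0\<close> for two generators gives \<open>z = \<alpha> x\<close>.

  The centralizer is computed in the representation of \<open>L\<close> on functions \<open>f\<close> of words with
  \<open>(x f)(w) = f(x w)\<close>. If \<open>z\<close> commutes with \<open>a\<close>, then \<open>f \<mapsto> (z f)([])\<close> vanishes on every function
  of the form \<open>w \<mapsto> g(a w) - g(w a)\<close>, and these are all functions that vanish on the powers of \<open>a\<close>;
  on the remaining functions \<open>z\<close> acts as a multiple of \<open>a\<close>.

  This representation is faithful in every characteristic. An element is killed by it iff it is killed by
  all representations on function spaces. Lazard elimination writes
  \<open>L(X)\<close> as the semidirect product of \<open>K a\<close> and \<open>L(Y)\<close> with \<open>Y = {(ad a)\<^sup>k b | b \<noteq> a}\<close>, and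
  coinduction shows that the \<open>L(Y)\<close>-component of a killed element is again killed. Every monomial of
  \<open>L(X)\<close> that contains \<open>a\<close> becomes shorter in \<open>L(Y)\<close>, so this descent ends.\<close>

section \<open>Bilinear identities and homomorphisms out of the free Lie algebra\<close>

context lie_algebra
begin

lemma bracket_zero_left [simp]: "bracket 0 x = 0"
  using bracket_add_left[of 0 0 x] by simp

lemma bracket_zero_right [simp]: "bracket x 0 = 0"
  using bracket_add_right[of x 0 0] by simp

lemma bracket_minus_left: "bracket (- x) y = - bracket x y"
  using bracket_add_left[of x "- x" y] by (simp add: eq_neg_iff_add_eq_0 add.commute)

lemma bracket_minus_right: "bracket x (- y) = - bracket x y"
  using bracket_add_right[of x y "- y"] by (simp add: eq_neg_iff_add_eq_0 add.commute)

lemma bracket_diff_left: "bracket (x - y) z = bracket x z - bracket y z"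
  using bracket_add_left[of x "- y" z] by (simp add: bracket_minus_left)

lemma bracket_swap: "bracket y x = - bracket x y"
proof -
  have "bracket (x + y) (x + y) = bracket y x + bracket x y"
    unfolding bracket_add_left bracket_add_right by (simp add: bracket_self add.commute)
  then show ?thesis by (simp add: bracket_self eq_neg_iff_add_eq_0)
qed

definition lift :: "('x \<Rightarrow> 'l) \<Rightarrow> ('x, 'k) free_lie \<Rightarrow> 'l" where
  "lift g = (THE h. lie_hom fl_scale fl_bracket scale bracket h \<and> (\<forall>x. h (fl_gen x) = g x))"

lemma lift_hom: "lie_hom fl_scale fl_bracket scale bracket (lift g)"
  and lift_gen [simp]: "lift g (fl_gen x) = g x"
  using theI'[OF free_lie_universal[of g]] unfolding lift_def by blast+

lemma lift_add [simp]: "lift g (x + y) = lift g x + lift g y"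
  and lift_scale [simp]: "lift g (fl_scale c x) = scale c (lift g x)"
  and lift_bracket [simp]: "lift g (fl_bracket x y) = bracket (lift g x) (lift g y)"
proof -
  interpret Vector_Spaces.linear fl_scale scale "lift g"
    using lift_hom[of g] by (simp add: lie_hom_def)
  show "lift g (x + y) = lift g x + lift g y" by (rule add)
  show "lift g (fl_scale c x) = scale c (lift g x)" by (rule scale)
  show "lift g (fl_bracket x y) = bracket (lift g x) (lift g y)"
    using lift_hom[of g] by (simp add: lie_hom_def)
qed

lemma lift_zero [simp]: "lift g 0 = 0"
  using lift_add[of g 0 0] by simp

end

text \<open>Every element is the class of an expression, so structural induction on expressions
  descends to the quotient.\<close>

lemma free_lie_induct [case_names gen zero add scale bracket]:
  assumes "\<And>x. P (fl_gen x)" and "P 0"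
    and "\<And>s t. P s \<Longrightarrow> P t \<Longrightarrow> P (s + t)"
    and "\<And>c s. P s \<Longrightarrow> P (fl_scale c s)"
    and "\<And>s t. P s \<Longrightarrow> P t \<Longrightarrow> P (fl_bracket s t)"
  shows "P z"
proof -
  have "P (abs_free_lie t)" for t
    using assms
    by (induction t)
      (simp_all add: fl_gen.abs_eq[symmetric] zero_free_lie.abs_eq[symmetric]
        plus_free_lie.abs_eq[symmetric] fl_scale.abs_eq[symmetric] fl_bracket.abs_eq[symmetric])
  then show ?thesis by (induct z rule: free_lie.abs_induct)
qed

section \<open>Derivations\<close>

definition derivation :: "(('x, 'k::field) free_lie \<Rightarrow> ('x, 'k) free_lie) \<Rightarrow> bool" where
  "derivation D \<longleftrightarrow> (\<forall>x y. D (x + y) = D x + D y) \<and> (\<forall>c x. D (fl_scale c x) = fl_scale c (D x)) \<and>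
     (\<forall>x y. D (fl_bracket x y) = fl_bracket (D x) y + fl_bracket x (D y))"

text \<open>A derivation is the second component of a homomorphism into \<open>L \<oplus> \<epsilon>L\<close> with \<open>\<epsilon>\<^sup>2 = 0\<close>.\<close>

interpretation dual: lie_algebra
  "\<lambda>c p. (fl_scale c (fst p), fl_scale c (snd p))"
  "\<lambda>p q. (fl_bracket (fst p) (fst q), fl_bracket (snd p) (fst q) + fl_bracket (fst p) (snd q))"
proof (unfold_locales, goal_cases)
  case (10 x y z)
  \<comment> \<open>The second component of the Jacobi identity expands by the product rule into
    three Jacobi identities, each with one argument replaced by its \<epsilon>-part.\<close>
  have "fl_bracket (snd x) (fl_bracket (fst y) (fst z)) + fl_bracket (fst y) (fl_bracket (fst z) (snd x))
      + fl_bracket (fst z) (fl_bracket (snd x) (fst y)) = 0"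
    "fl_bracket (fst x) (fl_bracket (snd y) (fst z)) + fl_bracket (snd y) (fl_bracket (fst z) (fst x))
      + fl_bracket (fst z) (fl_bracket (fst x) (snd y)) = 0"
    "fl_bracket (fst x) (fl_bracket (fst y) (snd z)) + fl_bracket (fst y) (fl_bracket (snd z) (fst x))
      + fl_bracket (snd z) (fl_bracket (fst x) (fst y)) = 0"
    by (rule free_lie.jacobi)+
  note sum = arg_cong2[OF arg_cong2[OF this(1) this(2), of "(+)"] this(3), of "(+)"]
  show ?case using sum
    using free_lie.jacobi[of "fst x" "fst y" "fst z"]
    by (simp add: prod_eq_iff free_lie.bracket_add_right ac_simps)
next
  case (9 x)
  show ?case
    using free_lie.bracket_swap[of "fst x" "snd x"]
    by (simp add: prod_eq_iff free_lie.bracket_self)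
qed (auto simp: prod_eq_iff free_lie.scale_right_distrib free_lie.scale_left_distrib
    free_lie.bracket_add_left free_lie.bracket_add_right
    free_lie.bracket_scale_left free_lie.bracket_scale_right ac_simps)

lemma derivation_exists: "\<exists>D. derivation D \<and> (\<forall>x. D (fl_gen x) = d x)"
proof -
  let ?h = "dual.lift (\<lambda>x. (fl_gen x, d x))"
  \<comment> \<open>The first component is an endomorphism that fixes the letters, hence the
    identity; the bracket of the target then becomes the product rule for the second
    component.\<close>
  have fst: "fst (?h z) = z" for z
    by (induction z rule: free_lie_induct) simp_all
  have "derivation (\<lambda>z. snd (?h z))"
    by (simp add: derivation_def fst)
  moreover have "snd (?h (fl_gen x)) = d x" for x by simp
  ultimately show ?thesis by blast
qed

lemma derivation_zero: "derivation D \<Longrightarrow> D 0 = 0"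
  unfolding derivation_def by (metis add_cancel_right_right)

text \<open>The semidirect product of a line \<open>K e\<close> and \<open>L\<close> with
  \<open>[e, u] = D u\<close>, where \<open>(c, u)\<close> stands for \<open>c e + u\<close>. The
  Jacobi identity with one argument \<open>e\<close> is the product rule of
  \<open>D\<close>.\<close>

lemma semidirect_lie_algebra:
  assumes "derivation D"
  shows "lie_algebra (\<lambda>c p. (c * fst p, fl_scale c (snd p)))
    (\<lambda>p q. (0, fl_scale (fst p) (D (snd q)) - fl_scale (fst q) (D (snd p))
       + fl_bracket (snd p) (snd q)))"
proof (unfold_locales, goal_cases)
  case (10 x y z)
  have D: "D (x + y) = D x + D y" "D (x - y) = D x - D y" "D (fl_scale c x) = fl_scale c (D x)"
    "D (fl_bracket x y) = fl_bracket (D x) y + fl_bracket x (D y)" for c x y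
    using assms unfolding derivation_def by (auto, metis diff_add_cancel eq_diff_eq)
  have br: "fl_bracket x (y - z) = fl_bracket x y - fl_bracket x z" for x y z :: "('a, 'b) free_lie"
    by (metis free_lie.bracket_add_right diff_add_cancel eq_diff_eq)
  \<comment> \<open>The mixed brackets occur in both orders; the instances of antisymmetry bring
    them to a common order in which they cancel.\<close>
  show ?case
    using free_lie.jacobi[of "snd x" "snd y" "snd z"]
      free_lie.bracket_swap[of "snd x" "D (snd y)"] free_lie.bracket_swap[of "snd y" "D (snd z)"]
      free_lie.bracket_swap[of "snd z" "D (snd x)"] free_lie.bracket_swap[of "snd y" "D (snd x)"]
      free_lie.bracket_swap[of "snd z" "D (snd y)"] free_lie.bracket_swap[of "snd x" "D (snd z)"]
    by (simp add: D br prod_eq_iff free_lie.bracket_add_right free_lie.scale_right_distrib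
        free_lie.bracket_scale_right free_lie.scale_right_diff_distrib algebra_simps)
next
  case (9 x)
  then show ?case by (simp add: free_lie.bracket_self prod_eq_iff)
qed (use assms in \<open>auto simp: derivation_def prod_eq_iff free_lie.scale_right_distrib
    free_lie.scale_left_distrib free_lie.scale_right_diff_distrib
    free_lie.bracket_add_left free_lie.bracket_add_right
    free_lie.bracket_scale_left free_lie.bracket_scale_right algebra_simps\<close>)

section \<open>Representations on spaces of functions\<close>

definition fscale :: "'k::field \<Rightarrow> ('i \<Rightarrow> 'k) \<Rightarrow> 'i \<Rightarrow> 'k" where
  "fscale c f = (\<lambda>i. c * f i)"

lemma fscale_apply [simp]: "fscale c f i = c * f i"
  by (simp add: fscale_def)

lemma fscale_zero [simp]: "fscale c 0 = 0" "fscale 0 f = 0"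
  by (simp_all add: fun_eq_iff)

text \<open>Source and target may have different index sets, so that this covers both the operators
  of a representation and maps between two representations.\<close>

definition linear_op :: "(('i \<Rightarrow> 'k::field) \<Rightarrow> 'j \<Rightarrow> 'k) \<Rightarrow> bool" where
  "linear_op T \<longleftrightarrow> (\<forall>f g. T (f + g) = T f + T g) \<and> (\<forall>c f. T (fscale c f) = fscale c (T f))"

lemma linear_opD:
  assumes "linear_op T"
  shows "T (f + g) = T f + T g" "T (fscale c f) = fscale c (T f)" "T 0 = 0" "T (f - g) = T f - T g"
proof -
  show add: "T (f + g) = T f + T g" for f g
    using assms by (simp add: linear_op_def)
  show "T (fscale c f) = fscale c (T f)"
    using assms by (simp add: linear_op_def)
  show "T 0 = 0" using add[of 0 0] by simp
  show "T (f - g) = T f - T g" using add[of "f - g" g] by simp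
qed

text \<open>The commutator is bilinear only on linear operators, which do not form a type, so
  \<open>free_lie_universal\<close> does not apply. The action is therefore defined on expressions
  and shown to respect \<open>lie_eq\<close>.\<close>

primrec act_expr ::
  "('x \<Rightarrow> ('i \<Rightarrow> 'k::field) \<Rightarrow> 'i \<Rightarrow> 'k) \<Rightarrow> ('x, 'k) lie_expr \<Rightarrow> ('i \<Rightarrow> 'k) \<Rightarrow> 'i \<Rightarrow> 'k" where
  "act_expr \<rho> (LGen x) f = \<rho> x f"
| "act_expr \<rho> LZero f = 0"
| "act_expr \<rho> (LAdd s t) f = act_expr \<rho> s f + act_expr \<rho> t f"
| "act_expr \<rho> (LScale c s) f = fscale c (act_expr \<rho> s f)"
| "act_expr \<rho> (LBr s t) f = act_expr \<rho> s (act_expr \<rho> t f) - act_expr \<rho> t (act_expr \<rho> s f)"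

lemma linear_op_act_expr:
  assumes "\<And>x. linear_op (\<rho> x)"
  shows "linear_op (act_expr \<rho> s)"
proof (induction s)
  case (LGen x)
  then show ?case using assms[of x] by (simp add: linear_op_def)
next
  case (LBr s t)
  then show ?case
    by (simp add: linear_op_def) (simp add: fun_eq_iff algebra_simps)
qed (simp_all add: linear_op_def algebra_simps fun_eq_iff)

lemma act_expr_cong:
  assumes "\<And>x. linear_op (\<rho> x)" "lie_eq s t"
  shows "act_expr \<rho> s f = act_expr \<rho> t f"
  using assms(2)
proof (induction arbitrary: f rule: lie_eq.induct)
  case (lie_cong_br s s' t t')
  then show ?case by simp
qed (simp_all add: linear_opD[OF linear_op_act_expr[OF assms(1)]] algebra_simps fun_eq_iff)

definition act ::
  "('x \<Rightarrow> ('i \<Rightarrow> 'k::field) \<Rightarrow> 'i \<Rightarrow> 'k) \<Rightarrow> ('x, 'k) free_lie \<Rightarrow> ('i \<Rightarrow> 'k) \<Rightarrow> 'i \<Rightarrow> 'k" where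
  "act \<rho> z = act_expr \<rho> (rep_free_lie z)"

context
  fixes \<rho> :: "'x \<Rightarrow> ('i \<Rightarrow> 'k::field) \<Rightarrow> 'i \<Rightarrow> 'k"
  assumes linear: "\<And>x. linear_op (\<rho> x)"
begin

lemma act_abs: "act \<rho> (abs_free_lie s) f = act_expr \<rho> s f"
  unfolding act_def
  by (intro act_expr_cong linear Quotient3_rep_abs[OF Quotient3_free_lie] lie_eq_refl)

lemma act_gen: "act \<rho> (fl_gen x) f = \<rho> x f"
  by (simp add: fl_gen.abs_eq act_abs)

lemma act_zero: "act \<rho> 0 f = 0"
  by (simp add: zero_free_lie.abs_eq act_abs)

lemma act_add: "act \<rho> (y + z) f = act \<rho> y f + act \<rho> z f"
  by (induct y rule: free_lie.abs_induct, induct z rule: free_lie.abs_induct)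
    (simp add: plus_free_lie.abs_eq act_abs)

lemma act_scale: "act \<rho> (fl_scale c z) f = fscale c (act \<rho> z f)"
  by (induct z rule: free_lie.abs_induct) (simp add: fl_scale.abs_eq act_abs)

lemma act_bracket:
  "act \<rho> (fl_bracket y z) f = act \<rho> y (act \<rho> z f) - act \<rho> z (act \<rho> y f)"
  by (induct y rule: free_lie.abs_induct, induct z rule: free_lie.abs_induct)
    (simp add: fl_bracket.abs_eq act_abs)

lemma linear_op_act: "linear_op (act \<rho> z)"
  unfolding act_def by (rule linear_op_act_expr[OF linear])

lemmas act_simps = act_gen act_zero act_add act_scale act_bracket

lemma act_diff: "act \<rho> (y - z) f = act \<rho> y f - act \<rho> z f"
  using act_add[of "y - z" z f] by simp

end

text \<open>Pulling a representation back along a homomorphism of free algebras gives a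
  representation again, determined by the images of the letters.\<close>

lemma act_lift:
  assumes "\<And>x. linear_op (\<rho> x)"
  shows "act \<rho> (free_lie.lift g z) f = act (\<lambda>x. act \<rho> (g x)) z f"
proof -
  have "linear_op (act \<rho> (g x))" for x by (rule linear_op_act[OF assms])
  note simps = act_simps[of "\<lambda>x. act \<rho> (g x)", OF this] act_simps[of \<rho>, OF assms]
  show ?thesis
    by (induction z arbitrary: f rule: free_lie_induct) (simp_all add: simps)
qed

text \<open>The dual of the right regular representation of the free associative algebra. Matrix coefficients
  map every other representation into it, so its kernel is the least possible.\<close>

definition word_op :: "'x \<Rightarrow> ('x list \<Rightarrow> 'k::field) \<Rightarrow> 'x list \<Rightarrow> 'k" where
  "word_op x f w = f (x # w)"

lemma linear_word_op: "linear_op (word_op x)"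
  by (simp add: linear_op_def word_op_def fun_eq_iff)

text \<open>The first letter of the word is applied first, which matches \<open>word_op x\<close>
  reading its argument at \<open>x # w\<close>.\<close>

primrec matrix_coeff ::
  "('x \<Rightarrow> ('i \<Rightarrow> 'k::field) \<Rightarrow> 'i \<Rightarrow> 'k) \<Rightarrow> 'i \<Rightarrow> 'x list \<Rightarrow> ('i \<Rightarrow> 'k) \<Rightarrow> 'k" where
  "matrix_coeff \<rho> i [] f = f i"
| "matrix_coeff \<rho> i (x # w) f = matrix_coeff \<rho> i w (\<rho> x f)"

text \<open>The map \<open>M\<close> to matrix coefficients intertwines \<rho> with the word
  representation, and its value at the empty word returns the coordinate \<open>i\<close>.\<close>

lemma act_eq_zero_if_word_act_eq_zero:
  assumes linear: "\<And>x. linear_op (\<rho> x)" and zero: "\<And>f. act word_op z f = 0"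
  shows "act \<rho> z f = 0"
proof
  fix i
  define M where "M f = (\<lambda>w. matrix_coeff \<rho> i w f)" for f
  have "matrix_coeff \<rho> i w (f + g) = matrix_coeff \<rho> i w f + matrix_coeff \<rho> i w g" for w f g
    by (induction w arbitrary: f g) (simp_all add: linear_opD[OF linear])
  moreover have "matrix_coeff \<rho> i w (fscale c f) = c * matrix_coeff \<rho> i w f" for w f c
    by (induction w arbitrary: f) (simp_all add: linear_opD[OF linear])
  ultimately have "linear_op M"
    by (simp add: linear_op_def M_def fun_eq_iff)
  note M = linear_opD[OF this]
  have "M (act \<rho> z f) = act word_op z (M f)" for z f
  proof (induction z arbitrary: f rule: free_lie_induct)
    case (gen x)
    then show ?case by (simp add: act_gen[OF linear] act_gen[OF linear_word_op]) (simp add: M_def word_op_def fun_eq_iff)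
  qed (simp_all add: act_simps[OF linear] act_simps[OF linear_word_op] M)
  then have "M (act \<rho> z f) = 0" by (simp add: zero)
  then have "M (act \<rho> z f) [] = 0" by simp
  then show "act \<rho> z f i = 0 i" by (simp add: M_def)
qed

section \<open>The centralizer of a letter in the word representation\<close>

text \<open>The action changes words only at the front, so it commutes with appending
  \<open>w\<close> at the end.\<close>

lemma act_word_shift:
  "act word_op z (\<lambda>u. f (u @ w)) v = act word_op z f (v @ w)"
proof (induction z arbitrary: f v rule: free_lie_induct)
  case (gen x)
  then show ?case by (simp add: act_gen[OF linear_word_op]) (simp add: word_op_def)
next
  case (bracket s t)
  have "act word_op s (\<lambda>u. f (u @ w)) = (\<lambda>v. act word_op s f (v @ w))"
    "act word_op t (\<lambda>u. f (u @ w)) = (\<lambda>v. act word_op t f (v @ w))"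
    by (simp_all add: bracket fun_eq_iff)
  then show ?case
    by (simp add: act_bracket[OF linear_word_op] bracket)
qed (simp_all add: act_simps[OF linear_word_op])

text \<open>Functions supported on the powers of \<open>a\<close> are stable under all letters, and
  letters other than \<open>a\<close> kill them. All elements therefore act on them as multiples of
  \<open>a\<close>, and brackets act as zero.\<close>

lemma act_word_power:
  "\<exists>c. \<forall>f. (\<forall>w. set w - {a} \<noteq> {} \<longrightarrow> f w = 0) \<longrightarrow> act word_op z f = fscale c (word_op a f)"
proof (induction z rule: free_lie_induct)
  case (gen x)
  have "act word_op (fl_gen x) f = fscale (if x = a then 1 else 0) (word_op a f)"
    if "\<forall>w. set w - {a} \<noteq> {} \<longrightarrow> f w = 0" for f
    using that by (auto simp: act_gen[OF linear_word_op] word_op_def fun_eq_iff)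
  then show ?case by blast
next
  case zero
  have "act word_op 0 f = fscale 0 (word_op a f)" for f
    by (simp add: act_zero[OF linear_word_op])
  then show ?case by blast
next
  case (add s t)
  then obtain c d where
    "\<And>f. (\<forall>w. set w - {a} \<noteq> {} \<longrightarrow> f w = 0) \<longrightarrow> act word_op s f = fscale c (word_op a f)"
    "\<And>f. (\<forall>w. set w - {a} \<noteq> {} \<longrightarrow> f w = 0) \<longrightarrow> act word_op t f = fscale d (word_op a f)"
    by blast
  then have "(\<forall>w. set w - {a} \<noteq> {} \<longrightarrow> f w = 0) \<longrightarrow>
      act word_op (s + t) f = fscale (c + d) (word_op a f)" for f
    by (auto simp: act_add[OF linear_word_op] fun_eq_iff algebra_simps)
  then show ?case by blast
next
  case (scale d s)
  then obtain c where
    "\<And>f. (\<forall>w. set w - {a} \<noteq> {} \<longrightarrow> f w = 0) \<longrightarrow> act word_op s f = fscale c (word_op a f)"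
    by blast
  then have "(\<forall>w. set w - {a} \<noteq> {} \<longrightarrow> f w = 0) \<longrightarrow>
      act word_op (fl_scale d s) f = fscale (d * c) (word_op a f)" for f
    by (auto simp: act_scale[OF linear_word_op] fun_eq_iff algebra_simps)
  then show ?case by blast
next
  case (bracket s t)
  then obtain c d where
    cd: "\<And>f. (\<forall>w. set w - {a} \<noteq> {} \<longrightarrow> f w = 0) \<Longrightarrow> act word_op s f = fscale c (word_op a f)"
    "\<And>f. (\<forall>w. set w - {a} \<noteq> {} \<longrightarrow> f w = 0) \<Longrightarrow> act word_op t f = fscale d (word_op a f)"
    by blast
  have "act word_op (fl_bracket s t) f = fscale 0 (word_op a f)"
    if f: "\<forall>w. set w - {a} \<noteq> {} \<longrightarrow> f w = 0" for f
  proof -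
    have "\<forall>w. set w - {a} \<noteq> {} \<longrightarrow> fscale e (word_op a f) w = 0" for e
      using f by (auto simp: word_op_def)
    then show ?thesis
      by (simp add: act_bracket[OF linear_word_op] cd f) (simp add: word_op_def fun_eq_iff)
  qed
  then show ?case by blast
qed

text \<open>Iterates \<open>g(a w) = f(w) + g(w a)\<close>; on a word that is not a power of \<open>a\<close> this ends once all
  leading letters \<open>a\<close> have been moved to the end.\<close>

primrec rotate_sum :: "('x list \<Rightarrow> 'k::field) \<Rightarrow> 'x \<Rightarrow> nat \<Rightarrow> 'x list \<Rightarrow> 'k" where
  "rotate_sum f a 0 w = 0"
| "rotate_sum f a (Suc m) w = f (tl w) + rotate_sum f a m (tl w @ [a])"

lemma ex_rotation_potential:
  assumes "\<And>w. set w - {a} = {} \<Longrightarrow> f w = (0 :: 'k::field)"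
  shows "\<exists>g. \<forall>w. f w = g (a # w) - g (w @ [a])"
proof -
  define g where
    "g w = (if set w - {a} = {} then 0 else rotate_sum f a (length (takeWhile (\<lambda>x. x = a) w)) w)" for w
  have "f w = g (a # w) - g (w @ [a])" for w
  proof (cases "set w - {a} = {}")
    case True
    then show ?thesis using assms by (simp add: g_def)
  next
    case False
    \<comment> \<open>Since another letter occurs, appending \<open>a\<close> does not change the
      number of leading letters \<open>a\<close>, while prepending \<open>a\<close> raises it by
      one; so the two sums differ by exactly one step of \<open>rotate_sum\<close>.\<close>
    then obtain x where "x \<in> set w" "x \<noteq> a" by blast
    then have "takeWhile (\<lambda>x. x = a) (w @ [a]) = takeWhile (\<lambda>x. x = a) w"
      by (rule takeWhile_append1)
    with False show ?thesis by (auto simp: g_def)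
  qed
  then show ?thesis by blast
qed

lemma word_centralizer:
  assumes comm: "\<And>f. act word_op (fl_bracket (fl_gen a) z) f = 0"
  shows "\<exists>c. \<forall>f. act word_op (z - fl_scale c (fl_gen a)) f = 0"
proof -
  note simps = act_simps[OF linear_word_op]
  obtain c where
    c: "\<And>f. (\<forall>w. set w - {a} \<noteq> {} \<longrightarrow> f w = 0) \<Longrightarrow> act word_op z f = fscale c (word_op a f)"
    using act_word_power[of a z] by blast
  have empty: "act word_op z f [] = c * f [a]" for f
  proof -
    \<comment> \<open>On \<open>f1\<close> the element \<open>z\<close> acts as \<open>c\<close>
      times \<open>a\<close>; \<open>f2\<close> has a rotation potential \<open>g\<close>, and there
      the value of \<open>z\<close> at the empty word is minus that of \<open>[a, z]\<close> on
      \<open>g\<close>, hence zero.\<close>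
    define f1 where "f1 w = (if set w - {a} = {} then f w else 0)" for w
    define f2 where "f2 w = (if set w - {a} = {} then 0 else f w)" for w
    have f: "f = f1 + f2" by (auto simp: f1_def f2_def fun_eq_iff)
    obtain g where g: "\<And>w. f2 w = g (a # w) - g (w @ [a])"
      using ex_rotation_potential[of a f2] by (auto simp: f2_def)
    have "f2 = word_op a g - (\<lambda>w. g (w @ [a]))"
      by (simp add: fun_eq_iff g word_op_def)
    then have "act word_op z f2 [] = act word_op z (word_op a g) [] - act word_op z g [a]"
      by (simp add: linear_opD[OF linear_op_act[OF linear_word_op]] act_word_shift)
    also have "\<dots> = 0"
      using fun_cong[OF comm[of g], of "[]"] by (simp add: simps word_op_def)
    finally have "act word_op z f [] = act word_op z f1 []"
      by (simp add: f linear_opD[OF linear_op_act[OF linear_word_op]])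
    also have "\<dots> = c * f [a]"
      by (subst c) (auto simp: f1_def word_op_def)
    finally show ?thesis .
  qed
  \<comment> \<open>The value at \<open>w\<close> is the value at the empty word for the translate
    of \<open>f\<close> by \<open>w\<close>.\<close>
  have "act word_op (z - fl_scale c (fl_gen a)) f w = 0" for f w
    using act_word_shift[of z f w "[]"] empty[of "\<lambda>u. f (u @ w)"]
    by (simp add: act_diff[OF linear_word_op] simps word_op_def)
  then show ?thesis by (auto simp: fun_eq_iff)
qed

section \<open>Bracket monomials\<close>

text \<open>A relation between an element and the length and letter set of some bracket expression
  for it. These are not unique: \<open>0\<close> is \<open>[x, x]\<close> for every letter
  \<open>x\<close>.\<close>

inductive bracket_monomial :: "nat \<Rightarrow> 'x set \<Rightarrow> ('x, 'k::field) free_lie \<Rightarrow> bool" where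
  gen: "bracket_monomial 1 {x} (fl_gen x)"
| bracket: "bracket_monomial m A s \<Longrightarrow> bracket_monomial n B t \<Longrightarrow>
    bracket_monomial (m + n) (A \<union> B) (fl_bracket s t)"

lemma bracket_monomial_pos:
  assumes "bracket_monomial m A s"
  shows "0 < m" "finite A" "A \<noteq> {}"
  using assms by (induction rule: bracket_monomial.induct) auto

definition length_below :: "nat \<Rightarrow> ('x, 'k::field) free_lie set" where
  "length_below n = free_lie.span {s. \<exists>m A. m < n \<and> bracket_monomial m A s}"

text \<open>A step between \<open>length_below n\<close> and \<open>length_below (Suc n)\<close>:
  monomials of top length \<open>n\<close> may use only letters of \<open>S\<close>. For finite
  \<open>S\<close>, the pair of \<open>n\<close> and \<open>card S\<close> measures the descent
  under elimination.\<close>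

definition length_filtration :: "nat \<Rightarrow> 'x set \<Rightarrow> ('x, 'k::field) free_lie set" where
  "length_filtration n S = free_lie.span
     ({s. \<exists>m A. m < n \<and> bracket_monomial m A s} \<union> {s. \<exists>A. A \<subseteq> S \<and> bracket_monomial n A s})"

lemma length_below_mono: "m \<le> n \<Longrightarrow> length_below m \<subseteq> length_below n"
  unfolding length_below_def by (intro free_lie.span_mono) (auto intro: less_le_trans)

lemma length_belowI: "bracket_monomial m A s \<Longrightarrow> m < n \<Longrightarrow> s \<in> length_below n"
  unfolding length_below_def by (intro free_lie.span_base) blast

lemma subspace_length_below: "free_lie.subspace (length_below n)"
  unfolding length_below_def by (rule free_lie.subspace_span)

lemmas length_below_closed =
  free_lie.subspace_add[OF subspace_length_below] free_lie.subspace_scale[OF subspace_length_below]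
  free_lie.subspace_0[OF subspace_length_below] free_lie.subspace_diff[OF subspace_length_below]

lemma length_below_induct [consumes 1, case_names zero monomial add scale]:
  assumes "z \<in> length_below n" and "P 0"
    and "\<And>m A s. m < n \<Longrightarrow> bracket_monomial m A s \<Longrightarrow> P s"
    and "\<And>s t. P s \<Longrightarrow> P t \<Longrightarrow> P (s + t)" and "\<And>c s. P s \<Longrightarrow> P (fl_scale c s)"
  shows "P z"
  using assms(1) unfolding length_below_def
  by (rule free_lie.span_induct) (use assms(2-) in \<open>auto intro!: free_lie.subspaceI\<close>)

text \<open>Lengths at most \<open>m - 1\<close> and at most \<open>n\<close> add up to less than
  \<open>m + n\<close>; one argument carries \<open>Suc\<close> because the bounds are
  strict.\<close>

lemma bracket_length_below:
  assumes "u \<in> length_below m" "v \<in> length_below (Suc n)"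
  shows "fl_bracket u v \<in> length_below (m + n)"
  using assms(1)
proof (induction rule: length_below_induct)
  case (monomial m' A s)
  note s = this
  show ?case
    using assms(2)
  proof (induction rule: length_below_induct)
    case (monomial n' B t)
    then show ?case using s by (intro length_belowI[OF bracket_monomial.bracket]) auto
  qed (simp_all add: length_below_closed free_lie.bracket_add_right free_lie.bracket_scale_right)
qed (simp_all add: length_below_closed free_lie.bracket_add_left free_lie.bracket_scale_left)

lemma ex_length_below: "\<exists>n. z \<in> length_below n"
proof (induction z rule: free_lie_induct)
  case (gen x)
  then show ?case by (blast intro: length_belowI[OF bracket_monomial.gen])
next
  case zero
  then show ?case by (blast intro: length_below_closed)
next
  case (add s t)
  then obtain m n where "s \<in> length_below m" "t \<in> length_below n" by blast
  then have "s \<in> length_below (max m n)" "t \<in> length_below (max m n)"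
    using length_below_mono[of m "max m n"] length_below_mono[of n "max m n"] by auto
  then show ?case by (blast intro: length_below_closed)
next
  case (scale c s)
  then show ?case by (blast intro: length_below_closed)
next
  case (bracket s t)
  then obtain m n where "s \<in> length_below m" "t \<in> length_below n" by blast
  moreover then have "t \<in> length_below (Suc n)" using length_below_mono[of n "Suc n"] by auto
  ultimately show ?case by (blast intro: bracket_length_below)
qed

text \<open>By the product rule \<open>D\<close> replaces one letter at a time by another letter,
  which preserves the length.\<close>

lemma derivation_length_below:
  assumes "derivation D" and gen: "\<And>x. \<exists>y. D (fl_gen x) = fl_gen y" and "u \<in> length_below n"
  shows "D u \<in> length_below n"
  using assms(3)
proof (induction rule: length_below_induct)
  case (monomial m A s)
  have "D s \<in> length_below (Suc m)"
    using monomial(2)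
  proof (induction rule: bracket_monomial.induct)
    case (gen x)
    obtain y where "D (fl_gen x) = fl_gen y" using assms(2) by blast
    then show ?case by (auto intro: length_belowI[OF bracket_monomial.gen])
  next
    case (bracket m A s n B t)
    then have "s \<in> length_below (Suc m)" "t \<in> length_below (Suc n)"
      by (auto intro: length_belowI)
    with bracket have "fl_bracket (D s) t \<in> length_below (Suc m + n)"
      "fl_bracket s (D t) \<in> length_below (Suc m + n)"
      by (auto intro: bracket_length_below simp del: add_Suc)
    then show ?case using assms(1) by (simp add: derivation_def length_below_closed)
  qed
  then show ?case using length_below_mono[of "Suc m" n] monomial(1) by auto
qed (use assms(1) in \<open>simp_all add: length_below_closed derivation_zero derivation_def\<close>)

text \<open>Every monomial contains a letter.\<close>

lemma length_filtration_empty: "length_filtration n {} = length_below n"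
proof -
  have "{s. \<exists>A. A \<subseteq> {} \<and> bracket_monomial n A s} = {}"
    by (auto dest: bracket_monomial_pos)
  from arg_cong[OF this] show ?thesis
    unfolding length_filtration_def length_below_def by (rule trans) (subst Un_empty_right, rule refl)
qed

lemma length_filtration_mono: "S \<subseteq> T \<Longrightarrow> length_filtration n S \<subseteq> length_filtration n T"
  unfolding length_filtration_def by (intro free_lie.span_mono) blast

text \<open>An element is a combination of finitely many monomials, each with finitely many letters;
  the set \<open>S\<close> collects them.\<close>

lemma length_below_Suc:
  assumes "z \<in> length_below (Suc n)"
  shows "\<exists>S. finite S \<and> z \<in> length_filtration n S"
  using assms
proof (induction rule: length_below_induct)
  case zero
  then show ?case unfolding length_filtration_def by (blast intro: free_lie.span_zero)
next
  case (monomial m A s)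
  then have "s \<in> length_filtration n A"
    unfolding length_filtration_def by (intro free_lie.span_base) (auto simp: less_Suc_eq)
  then show ?case using bracket_monomial_pos(2)[OF monomial(2)] by blast
next
  case (add s t)
  then obtain S T where "finite S" "finite T" "s \<in> length_filtration n S" "t \<in> length_filtration n T"
    by blast
  then have "finite (S \<union> T)" "s \<in> length_filtration n (S \<union> T)" "t \<in> length_filtration n (S \<union> T)"
    using length_filtration_mono[of S "S \<union> T" n] length_filtration_mono[of T "S \<union> T" n] by auto
  then show ?case unfolding length_filtration_def by (blast intro: free_lie.span_add)
next
  case (scale c s)
  then show ?case unfolding length_filtration_def by (blast intro: free_lie.span_scale)
qed

section \<open>Elimination of a letter\<close>

text \<open>The letter \<open>enc b k\<close> of \<open>Y\<close> stands for \<open>(ad a)\<^sup>k b\<close> with \<open>b \<noteq> a\<close>; the values \<open>enc a k\<close> are junk.\<close>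

locale letter_elimination =
  fixes a :: 'x and enc :: "'x \<Rightarrow> nat \<Rightarrow> 'y" and base :: "'y \<Rightarrow> 'x" and expo :: "'y \<Rightarrow> nat"
  assumes base_neq: "base y \<noteq> a"
    and enc_base_expo: "enc (base y) (expo y) = y"
    and base_enc: "b \<noteq> a \<Longrightarrow> base (enc b k) = b"
    and expo_enc: "b \<noteq> a \<Longrightarrow> expo (enc b k) = k"
begin

text \<open>The operator \<open>ad a\<close> seen on \<open>L(Y)\<close>: it sends the letter for
  \<open>(ad a)^k b\<close> to the one for \<open>(ad a)^(k+1) b\<close>.\<close>

definition shift :: "('y, 'k::field) free_lie \<Rightarrow> ('y, 'k) free_lie" where
  "shift = (SOME D. derivation D \<and> (\<forall>y. D (fl_gen y) = fl_gen (enc (base y) (Suc (expo y)))))"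

lemma derivation_shift: "derivation shift"
  and shift_gen: "shift (fl_gen y) = fl_gen (enc (base y) (Suc (expo y)))"
  using someI_ex[OF derivation_exists[of "\<lambda>y. fl_gen (enc (base y) (Suc (expo y)))"]]
  unfolding shift_def by blast+

lemma shift_simps:
  fixes u v :: "('y, 'k::field) free_lie"
  shows "shift (0 :: ('y, 'k) free_lie) = 0" "shift (u + v) = shift u + shift v" "shift (fl_scale c u) = fl_scale c (shift u)"
  "shift (fl_bracket u v) = fl_bracket (shift u) v + fl_bracket u (shift v)"
  using derivation_shift[where 'a = 'k] derivation_zero[OF derivation_shift]
  by (simp_all add: derivation_def)

definition embed :: "('y, 'k::field) free_lie \<Rightarrow> ('x, 'k) free_lie" where
  "embed = free_lie.lift (\<lambda>y. (fl_bracket (fl_gen a) ^^ expo y) (fl_gen (base y)))"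

lemma embed_simps:
  "embed (fl_gen y) = (fl_bracket (fl_gen a) ^^ expo y) (fl_gen (base y))"
  "embed 0 = 0" "embed (u + v) = embed u + embed v" "embed (fl_scale c u) = fl_scale c (embed u)"
  "embed (fl_bracket u v) = fl_bracket (embed u) (embed v)"
  by (simp_all add: embed_def)

lemma embed_diff: "embed (u - v) = embed u - embed v"
  using embed_simps(3)[of "u - v" v] by simp

text \<open>Both sides agree on letters, and both satisfy the product rule along
  \<open>embed\<close>; for the right side this is the Jacobi identity.\<close>

lemma embed_shift:
  fixes u :: "('y, 'k::field) free_lie"
  shows "embed (shift u) = fl_bracket (fl_gen a) (embed u)"
proof (induction u rule: free_lie_induct)
  case (bracket s t)
  have "fl_bracket (fl_gen a) (fl_bracket x y) =
      fl_bracket (fl_bracket (fl_gen a) x) y + fl_bracket x (fl_bracket (fl_gen a) y)"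
    for x y :: "('x, 'k) free_lie"
    using free_lie.jacobi[of "fl_gen a" x y] free_lie.bracket_swap[of y "fl_gen a"]
      free_lie.bracket_swap[of y "fl_bracket (fl_gen a) x"]
    by (simp add: free_lie.bracket_minus_right) (simp add: algebra_simps)
  with bracket show ?case by (simp add: shift_simps embed_simps)
qed (simp_all add: shift_simps shift_gen embed_simps base_neq base_enc expo_enc
    free_lie.bracket_add_right free_lie.bracket_scale_right)

text \<open>The homomorphism into the semidirect product of \<open>K\<close> and \<open>L(Y)\<close>
  in which \<open>(1, 0)\<close> acts as \<open>shift\<close> and is the image of
  \<open>a\<close>.\<close>

definition split :: "('x, 'k::field) free_lie \<Rightarrow> 'k \<times> ('y, 'k) free_lie" where
  "split = lie_algebra.lift (\<lambda>c p. (c * fst p, fl_scale c (snd p)))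
    (\<lambda>p q. (0, fl_scale (fst p) (shift (snd q)) - fl_scale (fst q) (shift (snd p))
       + fl_bracket (snd p) (snd q)))
    (\<lambda>x. if x = a then (1, 0) else (0, fl_gen (enc x 0)))"

lemma split_simps:
  fixes u v :: "('x, 'k::field) free_lie"
  shows "split (fl_gen x) = (if x = a then (1 :: 'k, 0) else (0, fl_gen (enc x 0)))"
  "split 0 = (0 :: 'k \<times> ('y, 'k) free_lie)" "split (u + v) = split u + split v"
  "split (fl_scale c u) = (c * fst (split u), fl_scale c (snd (split u)))"
  "split (fl_bracket u v) =
     (0, fl_scale (fst (split u)) (shift (snd (split v))) - fl_scale (fst (split v)) (shift (snd (split u)))
       + fl_bracket (snd (split u)) (snd (split v)))"
proof -
  interpret semidirect: lie_algebra "\<lambda>c p. (c * fst p, fl_scale c (snd p))"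
    "\<lambda>p q :: 'k \<times> ('y, 'k) free_lie.
      (0, fl_scale (fst p) (shift (snd q)) - fl_scale (fst q) (shift (snd p))
        + fl_bracket (snd p) (snd q))"
    by (rule semidirect_lie_algebra[OF derivation_shift])
  show "split (fl_gen x) = (if x = a then (1 :: 'k, 0) else (0, fl_gen (enc x 0)))"
    "split 0 = (0 :: 'k \<times> ('y, 'k) free_lie)"
    "split (u + v) = split u + split v"
    "split (fl_scale c u) = (c * fst (split u), fl_scale c (snd (split u)))"
    "split (fl_bracket u v) =
     (0, fl_scale (fst (split u)) (shift (snd (split v))) - fl_scale (fst (split v)) (shift (snd (split u)))
       + fl_bracket (snd (split u)) (snd (split v)))"
    unfolding split_def by simp_all
qed

text \<open>The map \<open>(c, u)\<close> to \<open>c a + embed u\<close> is a homomorphism on the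
  semidirect product by \<open>embed_shift\<close>, and its composition with \<open>split\<close>
  fixes the letters. In particular \<open>split\<close> is injective.\<close>

lemma embed_split:
  fixes z :: "('x, 'k::field) free_lie"
  shows "fl_scale (fst (split z)) (fl_gen a) + embed (snd (split z)) = z"
proof (induction z rule: free_lie_induct)
  case (bracket s t)
  define c d u v where "c = fst (split s)" "d = fst (split t)" "u = snd (split s)" "v = snd (split t)"
  have "embed (snd (split (fl_bracket s t))) =
      fl_scale c (fl_bracket (fl_gen a) (embed v)) - fl_scale d (fl_bracket (fl_gen a) (embed u))
      + fl_bracket (embed u) (embed v)"
    by (simp add: split_simps c_d_u_v_def embed_shift embed_simps embed_diff)
  also have "\<dots> = fl_bracket (fl_scale c (fl_gen a) + embed u) (fl_scale d (fl_gen a) + embed v)"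
    using free_lie.bracket_swap[of "embed u" "fl_gen a"]
    by (simp add: free_lie.bracket_add_left free_lie.bracket_add_right free_lie.bracket_scale_left
        free_lie.bracket_scale_right free_lie.bracket_self)
  also have "\<dots> = fl_bracket s t" using bracket by (simp add: c_d_u_v_def)
  finally show ?case by (simp add: split_simps)
next
  case (add s t)
  have "fl_scale (fst (split (s + t))) (fl_gen a) + embed (snd (split (s + t))) =
      (fl_scale (fst (split s)) (fl_gen a) + embed (snd (split s))) +
      (fl_scale (fst (split t)) (fl_gen a) + embed (snd (split t)))"
    by (simp add: split_simps embed_simps free_lie.scale_left_distrib)
  then show ?case by (simp only: add)
next
  case (scale c s)
  have "fl_scale (fst (split (fl_scale c s))) (fl_gen a) + embed (snd (split (fl_scale c s))) =
      fl_scale c (fl_scale (fst (split s)) (fl_gen a) + embed (snd (split s)))"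
    by (simp add: split_simps embed_simps free_lie.scale_right_distrib)
  then show ?case by (simp only: scale)
qed (simp_all add: split_simps embed_simps base_enc expo_enc)

text \<open>The letter \<open>a\<close> contributes nothing to the length in \<open>L(Y)\<close>:
  alone it has component \<open>0\<close>, and bracketing with it only applies \<open>shift\<close>.
  Other letters remain letters, so a monomial becomes shorter exactly through its occurrences of
  \<open>a\<close>.\<close>

lemma split_monomial:
  fixes s :: "('x, 'k::field) free_lie"
  assumes "bracket_monomial m A s"
  shows "snd (split s) \<in> length_below (Suc m)"
    and "a \<in> A \<Longrightarrow> snd (split s) \<in> length_below m"
    and "a \<notin> A \<Longrightarrow> fst (split s) = 0 \<and> bracket_monomial m ((\<lambda>b. enc b 0) ` A) (snd (split s))"
proof -
  have shift: "shift u \<in> length_below n" if "u \<in> length_below n" for n and u :: "('y, 'k) free_lie"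
    using derivation_length_below[OF derivation_shift _ that] shift_gen by blast
  have "snd (split s) \<in> length_below (Suc m) \<and> (a \<in> A \<longrightarrow> snd (split s) \<in> length_below m) \<and>
    (a \<notin> A \<longrightarrow> fst (split s) = 0 \<and> bracket_monomial m ((\<lambda>b. enc b 0) ` A) (snd (split s)))"
    using assms
  proof (induction rule: bracket_monomial.induct)
    case (gen x)
    then show ?case
      using bracket_monomial.gen[of "enc x 0"]
      by (auto simp: split_simps length_below_closed intro: length_belowI)
  next
    case (bracket m A s n B t)
    define c d u v where "c = fst (split s)" "d = fst (split t)" "u = snd (split s)" "v = snd (split t)"
    note defs = this
    have br: "snd (split (fl_bracket s t)) = fl_scale c (shift v) - fl_scale d (shift u) + fl_bracket u v"
      by (simp add: split_simps defs)
    have mn: "0 < m" "0 < n" using bracket bracket_monomial_pos by blast+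
    have u: "u \<in> length_below (Suc m)" and v: "v \<in> length_below (Suc n)"
      using bracket.IH by (simp_all add: defs)
    \<comment> \<open>As \<open>m\<close> and \<open>n\<close> are positive, the terms with
      \<open>shift\<close> are shorter than \<open>m + n\<close>; only \<open>[u, v]\<close> can
      reach the full length.\<close>
    then have "u \<in> length_below (m + n)" "v \<in> length_below (m + n)"
      using length_below_mono[of "Suc m" "m + n"] length_below_mono[of "Suc n" "m + n"] mn by auto
    then have lin: "fl_scale c (shift v) - fl_scale d (shift u) \<in> length_below (m + n)"
      by (intro length_below_closed shift)
    have "fl_bracket u v \<in> length_below (Suc (m + n))"
      using bracket_length_below[OF u v] by simp
    then have 1: "snd (split (fl_bracket s t)) \<in> length_below (Suc (m + n))"
      unfolding br using lin length_below_mono[of "m + n" "Suc (m + n)"]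
      by (intro length_below_closed(1)) auto
    have 2: "snd (split (fl_bracket s t)) \<in> length_below (m + n)" if "a \<in> A \<union> B"
    proof -
      have "fl_bracket u v \<in> length_below (m + n)"
      proof (cases "a \<in> A")
        case True
        then have "u \<in> length_below m" using bracket.IH by (simp add: defs)
        then show ?thesis using bracket_length_below[OF _ v] by blast
      next
        case False
        then have "v \<in> length_below n" using that bracket.IH by (simp add: defs)
        \<comment> \<open>The length bound for brackets is asymmetric, so the argument with the
          sharper bound is put first.\<close>
        then have "fl_bracket v u \<in> length_below (m + n)"
          using bracket_length_below[of v n u m] u by (simp add: add.commute)
        then show ?thesis
          by (simp add: free_lie.bracket_swap[of u v] free_lie.subspace_neg[OF subspace_length_below])
      qed
      then show ?thesis unfolding br using lin by (intro length_below_closed(1))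
    qed
    have 3: "bracket_monomial (m + n) ((\<lambda>b. enc b 0) ` (A \<union> B)) (snd (split (fl_bracket s t)))"
      if "a \<notin> A \<union> B"
    proof -
      have "c = 0" "d = 0" "bracket_monomial m ((\<lambda>b. enc b 0) ` A) u" "bracket_monomial n ((\<lambda>b. enc b 0) ` B) v"
        using that bracket.IH by (simp_all add: defs)
      then show ?thesis by (simp add: br image_Un bracket_monomial.bracket)
    qed
    show ?case using 1 2 3 by (auto simp: split_simps)
  qed
  then show "snd (split s) \<in> length_below (Suc m)" "a \<in> A \<Longrightarrow> snd (split s) \<in> length_below m"
    "a \<notin> A \<Longrightarrow> fst (split s) = 0 \<and> bracket_monomial m ((\<lambda>b. enc b 0) ` A) (snd (split s))"
    by blast+
qed

text \<open>The descent step: top monomials containing \<open>a\<close> fall below length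
  \<open>n\<close>, and the remaining ones use only the letters \<open>enc b 0\<close> with
  \<open>b\<close> in \<open>S - {a}\<close>.\<close>

lemma split_length_filtration:
  fixes z :: "('x, 'k::field) free_lie"
  assumes "z \<in> length_filtration n S"
  shows "snd (split z) \<in> length_filtration n ((\<lambda>b. enc b 0) ` (S - {a}))"
proof -
  have below: "length_below n \<subseteq> length_filtration n T" for T :: "'y set"
    using length_filtration_mono[of "{}" T n] by (simp add: length_filtration_empty)
  show ?thesis
    using assms unfolding length_filtration_def[of n S]
  proof (rule free_lie.span_induct)
    show "free_lie.subspace {z. snd (split z) \<in> length_filtration n ((\<lambda>b. enc b 0) ` (S - {a}))}"
      by (rule free_lie.subspaceI)
        (auto simp: split_simps length_filtration_def
          intro: free_lie.span_zero free_lie.span_add free_lie.span_scale)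
    fix s :: "('x, 'k) free_lie"
    assume "s \<in> {s. \<exists>m A. m < n \<and> bracket_monomial m A s} \<union> {s. \<exists>A. A \<subseteq> S \<and> bracket_monomial n A s}"
    then consider m A where "m < n" "bracket_monomial m A s"
      | A where "A \<subseteq> S" "bracket_monomial n A s" "a \<in> A"
      | A where "A \<subseteq> S" "bracket_monomial n A s" "a \<notin> A" by blast
    then show "snd (split s) \<in> length_filtration n ((\<lambda>b. enc b 0) ` (S - {a}))"
    proof cases
      case 1
      then show ?thesis using split_monomial(1) length_below_mono[of "Suc m" n] below by fastforce
    next
      case 2
      then show ?thesis using split_monomial(2) below by blast
    next
      case 3
      then have "(\<lambda>b. enc b 0) ` A \<subseteq> (\<lambda>b. enc b 0) ` (S - {a})" by blast
      then show ?thesis using split_monomial(3)[OF 3(2,3)]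
        unfolding length_filtration_def by (intro free_lie.span_base) blast
    qed
  qed
qed

text \<open>The representation of \<open>L(X)\<close> coinduced from a representation \<open>\<rho>\<close> of \<open>L(Y)\<close>: a vector is the
  sequence of its values at the powers of \<open>a\<close>, on which \<open>a\<close> acts as the shift, and
  \<open>coinduced_part \<rho> b i k\<close> is the \<open>i\<close>-th entry of the action of \<open>(ad a)\<^sup>k b\<close>.\<close>

primrec coinduced_part ::
  "('y \<Rightarrow> ('i \<Rightarrow> 'k::field) \<Rightarrow> 'i \<Rightarrow> 'k) \<Rightarrow> 'x \<Rightarrow> nat \<Rightarrow> nat \<Rightarrow> (nat \<times> 'i \<Rightarrow> 'k) \<Rightarrow> 'i \<Rightarrow> 'k" where
  "coinduced_part \<rho> b 0 k f = \<rho> (enc b k) (\<lambda>j. f (0, j))"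
| "coinduced_part \<rho> b (Suc i) k f =
     coinduced_part \<rho> b i (Suc k) f + coinduced_part \<rho> b i k (\<lambda>p. f (Suc (fst p), snd p))"

definition coinduced ::
  "('y \<Rightarrow> ('i \<Rightarrow> 'k::field) \<Rightarrow> 'i \<Rightarrow> 'k) \<Rightarrow> 'x \<Rightarrow> (nat \<times> 'i \<Rightarrow> 'k) \<Rightarrow> nat \<times> 'i \<Rightarrow> 'k" where
  "coinduced \<rho> x f p = (if x = a then f (Suc (fst p), snd p) else coinduced_part \<rho> x (fst p) 0 f (snd p))"

context
  fixes \<rho> :: "'y \<Rightarrow> ('i \<Rightarrow> 'k::field) \<Rightarrow> 'i \<Rightarrow> 'k"
  assumes linear: "\<And>y. linear_op (\<rho> y)"
begin

lemma linear_coinduced: "linear_op (coinduced \<rho> x)"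
proof -
  have slice: "(\<lambda>j. (f + g) (0, j)) = (\<lambda>j. f (0, j)) + (\<lambda>j. g (0, j))"
    "(\<lambda>p. (f + g) (Suc (fst p), snd p)) = (\<lambda>p. f (Suc (fst p), snd p)) + (\<lambda>p. g (Suc (fst p), snd p))"
    "(\<lambda>j. fscale c f (0, j)) = fscale c (\<lambda>j. f (0, j))"
    "(\<lambda>p. fscale c f (Suc (fst p), snd p)) = fscale c (\<lambda>p. f (Suc (fst p), snd p))"
    for f g :: "nat \<times> 'i \<Rightarrow> 'k" and c
    by (simp_all add: fun_eq_iff)
  have "coinduced_part \<rho> b i k (f + g) = coinduced_part \<rho> b i k f + coinduced_part \<rho> b i k g" for b i k f g
  proof (induction i arbitrary: k f g)
    case 0
    then show ?case by (simp only: coinduced_part.simps slice linear_opD[OF linear])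
  next
    case (Suc i)
    then show ?case by (simp only: coinduced_part.simps slice ac_simps)
  qed
  moreover have "coinduced_part \<rho> b i k (fscale c f) = fscale c (coinduced_part \<rho> b i k f)" for b i k f c
  proof (induction i arbitrary: k f)
    case 0
    then show ?case by (simp only: coinduced_part.simps slice linear_opD[OF linear])
  next
    case (Suc i)
    then show ?case
      by (simp only: coinduced_part.simps slice) (simp add: fun_eq_iff algebra_simps)
  qed
  ultimately show ?thesis
    by (simp add: linear_op_def fun_eq_iff coinduced_def)
qed

text \<open>The recursion for \<open>coinduced_part\<close>, solved for its term with
  \<open>Suc k\<close>, is the commutator of the shift with the operator of
  \<open>(ad a)^k b\<close>.\<close>

lemma coinduced_ad:
  assumes "b \<noteq> a"
  shows "act (coinduced \<rho>) ((fl_bracket (fl_gen a) ^^ k) (fl_gen b)) f p =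
    coinduced_part \<rho> b (fst p) k f (snd p)"
proof (induction k arbitrary: f p)
  case 0
  then show ?case using assms by (simp add: act_gen[OF linear_coinduced]) (simp add: coinduced_def)
next
  case (Suc k)
  have "coinduced \<rho> a f = (\<lambda>p. f (Suc (fst p), snd p))"
    by (simp add: fun_eq_iff coinduced_def)
  then show ?case
    by (simp add: act_bracket[OF linear_coinduced] act_gen[OF linear_coinduced] Suc)
      (simp add: coinduced_def Suc)
qed

text \<open>Reading the entry at \<open>0\<close> is a homomorphism of \<open>L(Y)\<close>-modules
  from the coinduced representation to \<rho>.\<close>

lemma coinduced_embed: "act (coinduced \<rho>) (embed u) f (0, j) = act \<rho> u (\<lambda>j. f (0, j)) j"
proof (induction u arbitrary: f j rule: free_lie_induct)
  case (gen y)
  then show ?case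
    by (simp add: embed_simps coinduced_ad base_neq enc_base_expo act_gen[OF linear])
next
  case (bracket s t)
  then show ?case
    by (simp add: embed_simps act_bracket[OF linear] act_bracket[OF linear_coinduced])
qed (simp_all add: embed_simps act_simps[OF linear] act_simps[OF linear_coinduced])

end

lemma word_act_split_eq_zero:
  assumes "\<And>f. act word_op z f = 0"
  shows "act word_op (snd (split z)) f = 0"
proof
  fix w
  \<comment> \<open>The sequence \<open>g\<close> is concentrated in entry \<open>0\<close>. At
    entry \<open>0\<close> the letter \<open>a\<close> reads entry \<open>1\<close>, so it
    contributes zero and only the \<open>L(Y)\<close>-component remains.\<close>
  define g where "g p = (if fst p = 0 then f (snd p) else 0)" for p :: "nat \<times> 'y list"
  note lin = linear_coinduced[of word_op, OF linear_word_op]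
  have "act (coinduced word_op) z g = 0"
    using act_eq_zero_if_word_act_eq_zero[of "coinduced word_op", OF lin assms] .
  then have "act (coinduced word_op)
      (fl_scale (fst (split z)) (fl_gen a) + embed (snd (split z))) g (0, w) = 0"
    by (simp only: embed_split) simp
  then show "act word_op (snd (split z)) f w = 0 w"
    by (simp add: act_simps[OF lin] coinduced_embed[OF linear_word_op])
      (simp add: coinduced_def g_def)
qed

end

section \<open>Faithfulness of the word representation and the centralizer of a letter\<close>

text \<open>The set of pairs of a letter other than \<open>a\<close> and an exponent is countably
  infinite. The new letters can thus again be natural numbers, and an induction over eliminations
  stays within one type.\<close>

lemma ex_letter_elimination:
  "\<exists>(enc :: nat \<Rightarrow> nat \<Rightarrow> nat) base expo. letter_elimination a enc base expo"
proof -
  have "infinite ((- {a}) \<times> (UNIV :: nat set))"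
    using infinite_UNIV_nat by (auto simp: finite_cartesian_product_iff Compl_eq_Diff_UNIV
        dest: finite_subset)
  then obtain f :: "nat \<Rightarrow> nat \<times> nat" where f: "bij_betw f UNIV ((- {a}) \<times> UNIV)"
    using bij_betw_from_nat_into[of "(- {a}) \<times> (UNIV :: nat set)"] by blast
  define enc where "enc b k = inv_into UNIV f (b, k)" for b k
  have "letter_elimination a enc (fst \<circ> f) (snd \<circ> f)"
  proof
    show "(fst \<circ> f) y \<noteq> a" for y using bij_betwE[OF f] by (metis ComplD UNIV_I comp_apply insertI1 mem_Times_iff)
    show "enc ((fst \<circ> f) y) ((snd \<circ> f) y) = y" for y
      using f by (simp add: enc_def bij_betw_def)
    have "f (enc b k) = (b, k)" if "b \<noteq> a" for b k
      unfolding enc_def by (rule f_inv_into_f) (use f that in \<open>simp add: bij_betw_def\<close>)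
    then show "b \<noteq> a \<Longrightarrow> (fst \<circ> f) (enc b k) = b" "b \<noteq> a \<Longrightarrow> (snd \<circ> f) (enc b k) = k" for b k
      by simp_all
  qed
  then show ?thesis by blast
qed

text \<open>Lexicographic induction on \<open>n\<close> and \<open>card S\<close>: eliminating a
  letter of \<open>S\<close> keeps \<open>n\<close> and lowers \<open>card S\<close>, and an empty
  \<open>S\<close> allows \<open>n\<close> to drop.\<close>

lemma word_act_faithful_nat:
  fixes z :: "(nat, 'k::field) free_lie"
  assumes "z \<in> length_filtration n S" "finite S" "\<And>f. act word_op z f = 0"
  shows "z = 0"
  using assms
proof (induction n arbitrary: z S)
  case 0
  have "length_filtration 0 S = ({0} :: (nat, 'k) free_lie set)" for S
  proof -
    have "{s :: (nat, 'k) free_lie. \<exists>A. A \<subseteq> S \<and> bracket_monomial 0 A s} = {}"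
      by (auto dest: bracket_monomial_pos(1))
    then show ?thesis unfolding length_filtration_def by (simp only: Un_empty_right) simp
  qed
  with 0 show ?case by blast
next
  case (Suc n)
  note IH = Suc.IH
  show ?case
    using Suc.prems
  proof (induction "card S" arbitrary: z S rule: less_induct)
    case less
    show ?case
    proof (cases "S = {}")
      case True
      \<comment> \<open>Here all monomials have length at most \<open>n\<close>, and a fresh finite
        set of letters covers those of length exactly \<open>n\<close>.\<close>
      then obtain T where "finite T" "z \<in> length_filtration n T"
        using length_below_Suc less.prems(1) by (auto simp: length_filtration_empty)
      then show ?thesis using IH less.prems(3) by blast
    next
      case False
      then obtain a where a: "a \<in> S" by blast
      obtain enc :: "nat \<Rightarrow> nat \<Rightarrow> nat" and base expo where "letter_elimination a enc base expo"
        using ex_letter_elimination by blast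
      then interpret letter_elimination a enc base expo .
      let ?T = "(\<lambda>b. enc b 0) ` (S - {a})"
      have "card ?T \<le> card (S - {a})" using less.prems(2) by (simp add: card_image_le)
      also have "\<dots> < card S" by (rule card_Diff1_less[OF less.prems(2) a])
      finally have "snd (split z) = 0"
        using less.hyps split_length_filtration[OF less.prems(1)] word_act_split_eq_zero[OF less.prems(3)]
          less.prems(2) by blast
      then have z: "z = fl_scale (fst (split z)) (fl_gen a)"
        using embed_split[of z] by (simp add: embed_simps)
      \<comment> \<open>The letter \<open>a\<close> fixes the constant function \<open>1\<close>, so
        this value is the coefficient of \<open>a\<close>.\<close>
      have "act word_op (fl_scale (fst (split z)) (fl_gen a)) (\<lambda>w. 1) [] = 0"
        using less.prems(3) z by (metis zero_fun_apply)
      then have "fst (split z) = 0"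
        by (simp add: act_simps[OF linear_word_op]) (simp add: word_op_def)
      then show ?thesis using z by simp
    qed
  qed
qed

text \<open>An injection of the letters into the natural numbers induces a map \<open>?J\<close>
  with left inverse \<open>?R\<close>. The word representation pulled back along \<open>?J\<close>
  is again a representation on functions, so \<open>z\<close> acts on it as zero and
  \<open>?J z\<close> is killed too.\<close>

theorem word_act_faithful:
  fixes z :: "('x, 'k::field) free_lie"
  assumes "countable (UNIV :: 'x set)" "\<And>f. act word_op z f = 0"
  shows "z = 0"
proof -
  obtain j :: "'x \<Rightarrow> nat" where j: "inj j" using assms(1) by (rule countableE)
  let ?J = "free_lie.lift (\<lambda>x. fl_gen (j x)) :: _ \<Rightarrow> (nat, 'k) free_lie"
  let ?R = "free_lie.lift (\<lambda>m. fl_gen (inv j m)) :: _ \<Rightarrow> ('x, 'k) free_lie"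
  have "?R (?J z) = z" for z
    using j by (induction z rule: free_lie_induct) simp_all
  moreover have "?J z = 0"
  proof -
    obtain n where "?J z \<in> length_below n" using ex_length_below by blast
    moreover have "act word_op (?J z) f = 0" for f
      unfolding act_lift[OF linear_word_op]
      by (rule act_eq_zero_if_word_act_eq_zero[OF linear_op_act[OF linear_word_op] assms(2)])
    ultimately show ?thesis
      using word_act_faithful_nat[of "?J z" n "{}"] by (simp add: length_filtration_empty)
  qed
  ultimately show ?thesis by (metis free_lie.lift_zero)
qed

theorem centralizer_gen:
  fixes z :: "('x, 'k::field) free_lie"
  assumes "countable (UNIV :: 'x set)" "fl_bracket (fl_gen a) z = 0"
  shows "\<exists>c. z = fl_scale c (fl_gen a)"
proof -
  have "act word_op (fl_bracket (fl_gen a) z) f = 0" for f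
    by (simp add: assms(2) act_zero[OF linear_word_op])
  then obtain c where "\<And>f. act word_op (z - fl_scale c (fl_gen a)) f = 0"
    using word_centralizer[of a z] by blast
  then have "z - fl_scale c (fl_gen a) = 0" by (rule word_act_faithful[OF assms(1)])
  then show ?thesis by auto
qed

section \<open>Independence of the letters\<close>

lemma abelian_lie_algebra: "lie_algebra ((*) :: 'k::field \<Rightarrow> 'k \<Rightarrow> 'k) (\<lambda>_ _. 0)"
  by unfold_locales (simp_all add: distrib_left distrib_right)

text \<open>The field as an abelian Lie algebra receives a homomorphism that is \<open>1\<close> on
  \<open>y\<close> and \<open>0\<close> on all other letters.\<close>

lemma gen_eq_scale_genD:
  assumes "fl_gen y = fl_scale c (fl_gen x :: ('x, 'k::field) free_lie)"
  shows "x = y"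
proof (rule ccontr)
  assume "x \<noteq> y"
  define h where "h = lie_algebra.lift ((*) :: 'k \<Rightarrow> 'k \<Rightarrow> 'k) (\<lambda>_ _. 0) (\<lambda>z. if z = y then 1 else 0)"
  have "h (fl_gen z) = (if z = y then 1 else 0)" for z
    unfolding h_def by (rule lie_algebra.lift_gen[OF abelian_lie_algebra])
  moreover have "h (fl_scale c z) = c * h z" for z
    unfolding h_def by (rule lie_algebra.lift_scale[OF abelian_lie_algebra])
  ultimately show False using arg_cong[OF assms, of h] \<open>x \<noteq> y\<close> by simp
qed

lemma gen_neq_zero: "fl_gen x \<noteq> (0 :: ('x, 'k::field) free_lie)"
proof
  assume zero: "fl_gen x = (0 :: ('x, 'k) free_lie)"
  have "(1 :: 'k) = 0"
    using lie_algebra.lift_gen[OF abelian_lie_algebra, of "\<lambda>_. 1 :: 'k" x]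
      lie_algebra.lift_zero[OF abelian_lie_algebra, of "\<lambda>_ :: 'x. 1 :: 'k"] zero by metis
  then show False by simp
qed

text \<open>Otherwise one letter would centralize the other and be a multiple of it.\<close>

lemma bracket_gen_neq_zero:
  assumes "countable (UNIV :: 'x set)" "x \<noteq> y"
  shows "fl_bracket (fl_gen x) (fl_gen y) \<noteq> (0 :: ('x, 'k::field) free_lie)"
  using centralizer_gen[OF assms(1)] gen_eq_scale_genD assms(2) by metis

section \<open>Closure properties of solution sets\<close>

lemma defined_by_system_eq:
  assumes "coeffs s \<union> coeffs t \<subseteq> C" "vars s \<union> vars t \<subseteq> {..<m}"
  shows "defined_by_system br C m {v. length v = m \<and> eval_term br v s = eval_term br v t}"
  unfolding defined_by_system_def
  by (rule exI[of _ "{(s, t)}"]) (use assms in \<open>auto simp: system_over_def solves_def\<close>)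

lemma defined_by_system_conj:
  assumes "defined_by_system br C m {v. length v = m \<and> P v}"
    and "defined_by_system br C m {v. length v = m \<and> Q v}"
  shows "defined_by_system br C m {v. length v = m \<and> P v \<and> Q v}"
proof -
  obtain \<Sigma> T where \<Sigma>: "system_over C m \<Sigma>" "{v. length v = m \<and> P v} = {v. length v = m \<and> solves br v \<Sigma>}"
    and T: "system_over C m T" "{v. length v = m \<and> Q v} = {v. length v = m \<and> solves br v T}"
    using assms unfolding defined_by_system_def by blast
  have "{v. length v = m \<and> P v \<and> Q v} = {v. length v = m \<and> P v} \<inter> {v. length v = m \<and> Q v}"
    by blast
  also have "\<dots> = {v. length v = m \<and> solves br v (\<Sigma> \<union> T)}"
    unfolding \<Sigma>(2) T(2) by (auto simp: solves_def)
  finally show ?thesis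
    using \<Sigma>(1) T(1) unfolding defined_by_system_def
    by (intro exI[of _ "\<Sigma> \<union> T"]) (auto simp: system_over_def)
qed

lemma defined_by_system_all_less:
  assumes "\<And>i. i < (n :: nat) \<Longrightarrow> defined_by_system br C m {v. length v = m \<and> P i v}"
  shows "defined_by_system br C m {v. length v = m \<and> (\<forall>i<n. P i v)}"
  using assms
proof (induction n)
  case 0
  show ?case unfolding defined_by_system_def
    by (rule exI[of _ "{}"]) (simp add: system_over_def solves_def)
next
  case (Suc n)
  then have "defined_by_system br C m {v. length v = m \<and> (\<forall>i<n. P i v) \<and> P n v}"
    by (intro defined_by_system_conj) simp_all
  moreover have "{v. length v = m \<and> (\<forall>i<n. P i v) \<and> P n v} = {v. length v = m \<and> (\<forall>i<Suc n. P i v)}"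
    by (auto simp: less_Suc_eq)
  ultimately show ?case by (simp only:)
qed

lemma defined_by_system_mono:
  "defined_by_system br C m X \<Longrightarrow> C \<subseteq> C' \<Longrightarrow> defined_by_system br C' m X"
  unfolding defined_by_system_def system_over_def by (elim exE) (rule exI, fastforce)

primrec shift_vars :: "nat \<Rightarrow> 'l eq_term \<Rightarrow> 'l eq_term" where
  "shift_vars k (Var i) = Var (k + i)"
| "shift_vars k (Coeff c) = Coeff c"
| "shift_vars k Zero = Zero"
| "shift_vars k (Add s t) = Add (shift_vars k s) (shift_vars k t)"
| "shift_vars k (Neg s) = Neg (shift_vars k s)"
| "shift_vars k (Br s t) = Br (shift_vars k s) (shift_vars k t)"

lemma vars_shift_vars: "vars (shift_vars k t) = (+) k ` vars t"
  by (induction t) (simp_all add: image_Un)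

lemma coeffs_shift_vars: "coeffs (shift_vars k t) = coeffs t"
  by (induction t) simp_all

lemma eval_shift_vars:
  assumes "vars t \<subseteq> {..<m}" "k + m \<le> length v"
  shows "eval_term br v (shift_vars k t) = eval_term br (take m (drop k v)) t"
  using assms by (induction t) simp_all

text \<open>Renaming the unknowns moves a system to the block of \<open>m\<close> positions that
  starts at \<open>k\<close>.\<close>

lemma defined_by_system_block:
  assumes "defined_by_system br C m X" "k + m \<le> M"
  shows "defined_by_system br C M {v. length v = M \<and> take m (drop k v) \<in> X}"
proof -
  obtain \<Sigma> where \<Sigma>: "system_over C m \<Sigma>" "X = {v. length v = m \<and> solves br v \<Sigma>}"
    using assms(1) unfolding defined_by_system_def by blast
  let ?T = "(\<lambda>(s, t). (shift_vars k s, shift_vars k t)) ` \<Sigma>"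
  have "system_over C M ?T"
    using \<Sigma>(1) assms(2)
    by (fastforce simp: system_over_def vars_shift_vars coeffs_shift_vars)
  moreover have "solves br v ?T \<longleftrightarrow> solves br (take m (drop k v)) \<Sigma>" if "length v = M" for v
    using \<Sigma>(1) assms(2) that unfolding solves_def system_over_def
    by (fastforce simp: eval_shift_vars[where m = m])
  then have "{v. length v = M \<and> take m (drop k v) \<in> X} = {v. length v = M \<and> solves br v ?T}"
    using assms(2) by (auto simp: \<Sigma>(2))
  ultimately show ?thesis unfolding defined_by_system_def by blast
qed

lemma e_definable_if_defined_by_system:
  "defined_by_system br C m X \<Longrightarrow> e_definable br m X"
  unfolding defined_by_system_def e_definable_def
  by (elim exE, rule exI[of _ 0], rule exI) (auto simp: system_over_def)

section \<open>Scalars in a free Lie algebra\<close>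

locale finite_basis =
  fixes xs :: "'x list" and n :: nat
  assumes two_letters: "n \<ge> 2" and distinct_letters: "distinct xs"
    and all_letters: "set xs = UNIV" and length_letters: "length xs = n"
begin

abbreviation basis :: "('x, 'k::field) free_lie list" where
  "basis \<equiv> map fl_gen xs"

abbreviation scalars :: "('x, 'k::field) free_lie list set" where
  "scalars \<equiv> range (scalar_tuple fl_scale basis)"

abbreviation scalar :: "('x, 'k::field) free_lie list \<Rightarrow> 'k" where
  "scalar \<equiv> scalar_of fl_scale basis"

lemma countable_letters: "countable (UNIV :: 'x set)"
  by (metis all_letters countable_finite finite_set)

lemma nth_scalar_tuple:
  "i < n \<Longrightarrow> scalar_tuple fl_scale basis \<alpha> ! i = fl_scale \<alpha> (basis ! i)"
  by (simp add: scalar_tuple_def length_letters)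

lemma length_scalar_tuple [simp]: "length (scalar_tuple s basis \<alpha>) = n"
  by (simp add: scalar_tuple_def length_letters)

lemma bracket_basis_neq_zero:
  "i < n \<Longrightarrow> j < n \<Longrightarrow> i \<noteq> j \<Longrightarrow> fl_bracket (basis ! i) (basis ! j) \<noteq> (0 :: ('x, 'k::field) free_lie)"
  using bracket_gen_neq_zero[OF countable_letters, of "xs ! i" "xs ! j"] distinct_letters
  by (simp add: length_letters nth_eq_iff_index_eq)

lemma scalar_scalar_tuple: "scalar (scalar_tuple fl_scale basis \<alpha>) = (\<alpha> :: 'k::field)"
  unfolding scalar_of_def
proof (rule the_equality)
  fix \<beta> assume eq: "scalar_tuple fl_scale basis \<alpha> = scalar_tuple fl_scale basis \<beta>"
  have "0 < n" using two_letters by simp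
  then show "\<beta> = \<alpha>"
    using arg_cong[OF eq, of "\<lambda>v. v ! 0"] gen_neq_zero[of "xs ! 0", where 'k = 'k]
    by (simp add: nth_scalar_tuple length_letters)
qed simp

text \<open>Commuting with the first letter makes \<open>z\<close> a multiple of it, and commuting
  with the second makes the coefficient zero.\<close>

lemma central_basis:
  assumes "\<And>i. i < n \<Longrightarrow> fl_bracket z (basis ! i) = 0"
  shows "z = 0"
proof -
  have comm: "\<exists>c. z = fl_scale c (basis ! i)" if "i < n" for i
    using centralizer_gen[OF countable_letters, of "xs ! i" z] assms[OF that] that
      free_lie.bracket_swap[of "fl_gen (xs ! i)" z] by (simp add: length_letters)
  obtain c where c: "z = fl_scale c (basis ! 0)" using comm[of 0] two_letters by auto
  have "fl_scale c (fl_bracket (basis ! 0) (basis ! 1)) = 0"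
    using assms[of 1] two_letters by (simp add: c free_lie.bracket_scale_left)
  then have "c = 0" using bracket_basis_neq_zero[of 0 1] two_letters by auto
  then show ?thesis by (simp add: c)
qed

lemma scale_iff_brackets:
  "z = fl_scale \<alpha> x \<longleftrightarrow>
    (\<forall>i<n. fl_bracket z (basis ! i) = fl_bracket x (scalar_tuple fl_scale basis \<alpha> ! i))"
proof
  assume R: "\<forall>i<n. fl_bracket z (basis ! i) = fl_bracket x (scalar_tuple fl_scale basis \<alpha> ! i)"
  have "z - fl_scale \<alpha> x = 0"
    by (rule central_basis)
      (simp add: R nth_scalar_tuple free_lie.bracket_diff_left free_lie.bracket_scale_left free_lie.bracket_scale_right)
  then show "z = fl_scale \<alpha> x" by simp
qed (simp add: nth_scalar_tuple free_lie.bracket_scale_left free_lie.bracket_scale_right)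

lemma scalars_iff:
  fixes v :: "('x, 'k::field) free_lie list"
  shows "v \<in> scalars \<longleftrightarrow> length v = n \<and> (\<forall>i<n. fl_bracket (v ! i) (basis ! i) = 0) \<and>
    (\<forall>i<n. \<forall>j<n. fl_bracket (v ! i) (basis ! j) = fl_bracket (basis ! i) (v ! j))"
proof
  assume "v \<in> scalars"
  then show "length v = n \<and> (\<forall>i<n. fl_bracket (v ! i) (basis ! i) = 0) \<and>
    (\<forall>i<n. \<forall>j<n. fl_bracket (v ! i) (basis ! j) = fl_bracket (basis ! i) (v ! j))"
    by (auto simp: nth_scalar_tuple free_lie.bracket_scale_left free_lie.bracket_scale_right free_lie.bracket_self)
next
  assume R: "length v = n \<and> (\<forall>i<n. fl_bracket (v ! i) (basis ! i) = 0) \<and>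
    (\<forall>i<n. \<forall>j<n. fl_bracket (v ! i) (basis ! j) = fl_bracket (basis ! i) (v ! j))"
  have "\<exists>c. v ! i = fl_scale c (basis ! i)" if "i < n" for i
    using centralizer_gen[OF countable_letters, of "xs ! i" "v ! i"] R that
      free_lie.bracket_swap[of "fl_gen (xs ! i)" "v ! i"] by (simp add: length_letters)
  then obtain c where c: "\<And>i. i < n \<Longrightarrow> v ! i = fl_scale (c i) (basis ! i)" by metis
  have c0: "c i = c 0" if "i < n" for i
  proof (cases "i = 0")
    case False
    \<comment> \<open>The mixed equation for the indices \<open>i\<close> and \<open>0\<close>
      compares the two coefficients on a nonzero bracket.\<close>
    have "fl_scale (c i) (fl_bracket (basis ! i) (basis ! 0)) = fl_scale (c 0) (fl_bracket (basis ! i) (basis ! 0))"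
      using R that two_letters c[OF that] c[of 0]
      by (metis free_lie.bracket_scale_left free_lie.bracket_scale_right less_le_trans zero_less_numeral)
    moreover have "fl_bracket (basis ! i) (basis ! 0) \<noteq> (0 :: ('x, 'k) free_lie)"
      using bracket_basis_neq_zero[of i 0] that False two_letters by simp
    ultimately show ?thesis by (simp only: free_lie.scale_right_imp_eq)
  qed simp
  have "v = scalar_tuple fl_scale basis (c 0)"
  proof (rule nth_equalityI)
    show "length v = length (scalar_tuple fl_scale basis (c 0))" using R by simp
    show "v ! i = scalar_tuple fl_scale basis (c 0) ! i" if "i < length v" for i
      using R that c[of i] c0[of i] by (simp only: nth_scalar_tuple)
  qed
  then show "v \<in> scalars" by blast
qed

section \<open>The interpretation of the field and of its action\<close>

lemma defined_scalars: "defined_by_system fl_bracket (set basis) n (scalars :: ('x, 'k::field) free_lie list set)"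
proof -
  let ?b = "basis :: ('x, 'k) free_lie list"
  have coeff: "?b ! i \<in> set ?b" if "i < n" for i
    using that by (simp add: length_letters)
  have "defined_by_system fl_bracket (set ?b) n {v. length v = n \<and> fl_bracket (v ! i) (?b ! i) = 0}"
    if "i < n" for i
    using defined_by_system_eq[of "Br (Var i) (Coeff (?b ! i))" Zero "set ?b" n fl_bracket] that coeff[OF that]
    by simp
  moreover have "defined_by_system fl_bracket (set ?b) n
      {v. length v = n \<and> fl_bracket (v ! i) (?b ! j) = fl_bracket (?b ! i) (v ! j)}"
    if "i < n" "j < n" for i j
    using defined_by_system_eq[of "Br (Var i) (Coeff (?b ! j))" "Br (Coeff (?b ! i)) (Var j)" "set ?b" n fl_bracket]
      that coeff by simp
  ultimately have "defined_by_system fl_bracket (set ?b) n {v. length v = n \<and>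
      (\<forall>i<n. fl_bracket (v ! i) (?b ! i) = 0) \<and>
      (\<forall>i<n. \<forall>j<n. fl_bracket (v ! i) (?b ! j) = fl_bracket (?b ! i) (v ! j))}"
    by (intro defined_by_system_conj defined_by_system_all_less)
  moreover have "scalars = {v. length v = n \<and> (\<forall>i<n. fl_bracket (v ! i) (?b ! i) = 0) \<and>
      (\<forall>i<n. \<forall>j<n. fl_bracket (v ! i) (?b ! j) = fl_bracket (?b ! i) (v ! j))}"
    by (rule set_eqI) (simp only: scalars_iff mem_Collect_eq)
  ultimately show ?thesis by (simp only:)
qed

lemma defined_scalars_block:
  "k + n \<le> M \<Longrightarrow> defined_by_system fl_bracket UNIV M
    {v. length v = M \<and> take n (drop k v) \<in> (scalars :: ('x, 'k::field) free_lie list set)}"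
  by (rule defined_by_system_block[OF defined_by_system_mono[OF defined_scalars subset_UNIV]])

text \<open>Three blocks are required to be scalar tuples by their own equations, so
  \<open>Q\<close> has to describe the operation only on such tuples. This treats sum and product
  alike.\<close>

lemma e_definable_binary_graph:
  fixes Q :: "('x, 'k::field) free_lie list \<Rightarrow> bool"
  assumes Q: "defined_by_system fl_bracket UNIV (2 * n + n) {w. length w = 2 * n + n \<and> Q w}"
    and iff: "\<And>\<alpha> \<beta> \<gamma>. Q (scalar_tuple fl_scale basis \<alpha> @ scalar_tuple fl_scale basis \<beta> @
       scalar_tuple fl_scale basis \<gamma>) \<longleftrightarrow> \<gamma> = f [\<alpha>, \<beta>]"
  shows "e_definable fl_bracket (2 * n + n)
    {concat us @ v | us v. length us = 2 \<and> set us \<subseteq> scalars \<and> v \<in> scalars \<and> scalar v = f (map scalar us)}"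
proof -
  let ?s = "scalar_tuple fl_scale basis :: 'k \<Rightarrow> ('x, 'k) free_lie list"
  have "{concat us @ v | us v. length us = 2 \<and> set us \<subseteq> scalars \<and> v \<in> scalars \<and> scalar v = f (map scalar us)}
    = {?s \<alpha> @ ?s \<beta> @ ?s (f [\<alpha>, \<beta>]) | \<alpha> \<beta>. True}" (is "?L = ?M")
  proof (intro subset_antisym subsetI)
    fix w assume "w \<in> ?L"
    then obtain us v where w: "w = concat us @ v" "length us = 2" "set us \<subseteq> scalars" "v \<in> scalars"
      "scalar v = f (map scalar us)" by blast
    then obtain u1 u2 where us: "us = [u1, u2]" by (auto simp: length_Suc_conv numeral_2_eq_2)
    then obtain \<alpha> \<beta> \<gamma> where "u1 = ?s \<alpha>" "u2 = ?s \<beta>" "v = ?s \<gamma>" using w by auto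
    with w us show "w \<in> ?M" by (auto simp: scalar_scalar_tuple)
  next
    fix w assume "w \<in> ?M"
    then obtain \<alpha> \<beta> where "w = ?s \<alpha> @ ?s \<beta> @ ?s (f [\<alpha>, \<beta>])" by blast
    then show "w \<in> ?L"
      by (intro CollectI exI[of _ "[?s \<alpha>, ?s \<beta>]"] exI[of _ "?s (f [\<alpha>, \<beta>])"]) (simp add: scalar_scalar_tuple)
  qed
  also have "\<dots> = {w. length w = 2 * n + n \<and> take n (drop 0 w) \<in> scalars \<and> take n (drop n w) \<in> scalars \<and>
      take n (drop (2 * n) w) \<in> scalars \<and> Q w}" (is "_ = ?R")
  proof (intro subset_antisym subsetI)
    fix w assume "w \<in> ?M"
    then show "w \<in> ?R" using iff by (auto simp: mult_2)
  next
    fix w assume w: "w \<in> ?R"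
    then obtain \<alpha> \<beta> \<gamma> where
      s: "take n (drop 0 w) = ?s \<alpha>" "take n (drop n w) = ?s \<beta>" "take n (drop (2 * n) w) = ?s \<gamma>"
      by auto
    have "w = take n w @ take n (drop n w) @ drop n (drop n w)"
      by (metis append_take_drop_id)
    then have "w = ?s \<alpha> @ ?s \<beta> @ ?s \<gamma>" using s w by (simp add: mult_2)
    then show "w \<in> ?M" using w iff by auto
  qed
  finally have eq: "?L = ?R" .
  have "defined_by_system fl_bracket UNIV (2 * n + n) ?R"
    by (intro defined_by_system_conj defined_scalars_block Q) simp_all
  then show ?thesis unfolding eq by (rule e_definable_if_defined_by_system)
qed

lemma e_interpretation_scalars:
  "e_interpretation fl_bracket n scalars scalar (UNIV :: 'k::field set) field_functions {}"
proof -
  let ?s = "scalar_tuple fl_scale basis :: 'k \<Rightarrow> ('x, 'k) free_lie list"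
  let ?b = "basis :: ('x, 'k) free_lie list"
  have "{u @ v | u v. u \<in> scalars \<and> v \<in> scalars \<and> scalar u = (scalar v :: 'k)} = {?s \<alpha> @ ?s \<alpha> | \<alpha>. True}"
    by (auto simp: scalar_scalar_tuple)
  also have "\<dots> = {w. length w = 2 * n \<and> take n (drop 0 w) \<in> scalars \<and> (\<forall>i<n. w ! i = w ! (n + i))}"
    (is "?M = ?R")
  proof (intro subset_antisym subsetI)
    fix w assume "w \<in> ?M"
    then show "w \<in> ?R" by (auto simp: nth_append)
  next
    fix w assume w: "w \<in> ?R"
    then obtain \<alpha> where \<alpha>: "take n w = ?s \<alpha>" by auto
    moreover have "drop n w = take n w" using w by (intro nth_equalityI) auto
    ultimately have "w = ?s \<alpha> @ ?s \<alpha>" by (metis append_take_drop_id)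
    then show "w \<in> ?M" by blast
  qed
  finally have eq_set: "{u @ v | u v. u \<in> scalars \<and> v \<in> scalars \<and> scalar u = (scalar v :: 'k)} = ?R" .
  have "defined_by_system fl_bracket UNIV (2 * n)
      {w :: ('x, 'k) free_lie list. length w = 2 * n \<and> w ! i = w ! (n + i)}" if "i < n" for i
    using defined_by_system_eq[of "Var i" "Var (n + i)" UNIV "2 * n" fl_bracket] that by simp
  then have "defined_by_system fl_bracket UNIV (2 * n) ?R"
    by (intro defined_by_system_conj defined_by_system_all_less defined_scalars_block) auto
  then have eq: "e_definable fl_bracket (2 * n)
      {u @ v | u v. u \<in> scalars \<and> v \<in> scalars \<and> scalar u = (scalar v :: 'k)}"
    unfolding eq_set by (rule e_definable_if_defined_by_system)
  have add: "e_definable fl_bracket (2 * n + n)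
    {concat us @ v | us v. length us = 2 \<and> set us \<subseteq> scalars \<and> v \<in> scalars \<and>
      scalar v = (\<lambda>v. v ! 0 + v ! 1 :: 'k) (map scalar us)}"
  proof (rule e_definable_binary_graph[where Q = "\<lambda>w. \<forall>i<n. w ! (2 * n + i) = w ! i + w ! (n + i)"])
    have "defined_by_system fl_bracket UNIV (2 * n + n)
        {w :: ('x, 'k) free_lie list. length w = 2 * n + n \<and> w ! (2 * n + i) = w ! i + w ! (n + i)}"
      if "i < n" for i
      using defined_by_system_eq[of "Var (2 * n + i)" "Add (Var i) (Var (n + i))" UNIV "2 * n + n" fl_bracket] that
      by simp
    then show "defined_by_system fl_bracket UNIV (2 * n + n)
        {w :: ('x, 'k) free_lie list. length w = 2 * n + n \<and> (\<forall>i<n. w ! (2 * n + i) = w ! i + w ! (n + i))}"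
      by (rule defined_by_system_all_less)
    fix \<alpha> \<beta> \<gamma> :: 'k
    have "(\<forall>i<n. (?s \<alpha> @ ?s \<beta> @ ?s \<gamma>) ! (2 * n + i) =
        (?s \<alpha> @ ?s \<beta> @ ?s \<gamma>) ! i + (?s \<alpha> @ ?s \<beta> @ ?s \<gamma>) ! (n + i)) \<longleftrightarrow>
        (\<forall>i<n. fl_scale \<gamma> (?b ! i) = fl_scale (\<alpha> + \<beta>) (?b ! i))"
      by (auto simp: nth_append nth_scalar_tuple free_lie.scale_left_distrib)
    also have "\<dots> \<longleftrightarrow> \<gamma> = \<alpha> + \<beta>"
      using two_letters gen_neq_zero[of "xs ! 0", where 'k = 'k]
      by (auto simp: length_letters dest!: spec[of _ 0])
    finally show "(\<forall>i<n. (?s \<alpha> @ ?s \<beta> @ ?s \<gamma>) ! (2 * n + i) =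
        (?s \<alpha> @ ?s \<beta> @ ?s \<gamma>) ! i + (?s \<alpha> @ ?s \<beta> @ ?s \<gamma>) ! (n + i)) \<longleftrightarrow> \<gamma> = [\<alpha>, \<beta>] ! 0 + [\<alpha>, \<beta>] ! 1"
      by simp
  qed
  \<comment> \<open>On scalar tuples the two sides are \<gamma> and
    \<open>\<alpha> * \<beta>\<close> times the bracket of two basis elements: bilinearity of the
    bracket encodes multiplication in \<open>K\<close>.\<close>
  let ?Q = "\<lambda>w. \<forall>i<n. \<forall>j<n. fl_bracket (w ! (2 * n + i)) (?b ! j) = fl_bracket (w ! i) (w ! (n + j))"
  have mult: "e_definable fl_bracket (2 * n + n)
    {concat us @ v | us v. length us = 2 \<and> set us \<subseteq> scalars \<and> v \<in> scalars \<and>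
      scalar v = (\<lambda>v. v ! 0 * v ! 1 :: 'k) (map scalar us)}"
  proof (rule e_definable_binary_graph[where Q = ?Q])
    have "defined_by_system fl_bracket UNIV (2 * n + n) {w. length w = 2 * n + n \<and>
        fl_bracket (w ! (2 * n + i)) (?b ! j) = fl_bracket (w ! i) (w ! (n + j))}" if "i < n" "j < n" for i j
      using defined_by_system_eq[of "Br (Var (2 * n + i)) (Coeff (?b ! j))" "Br (Var i) (Var (n + j))"
          UNIV "2 * n + n" fl_bracket] that
      by simp
    then show "defined_by_system fl_bracket UNIV (2 * n + n) {w. length w = 2 * n + n \<and> ?Q w}"
      by (intro defined_by_system_all_less)
    fix \<alpha> \<beta> \<gamma> :: 'k
    have "?Q (?s \<alpha> @ ?s \<beta> @ ?s \<gamma>) \<longleftrightarrow>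
        (\<forall>i<n. \<forall>j<n. fl_scale \<gamma> (fl_bracket (?b ! i) (?b ! j)) = fl_scale (\<alpha> * \<beta>) (fl_bracket (?b ! i) (?b ! j)))"
      by (auto simp: nth_append nth_scalar_tuple free_lie.bracket_scale_left free_lie.bracket_scale_right mult.commute)
    also have "\<dots> \<longleftrightarrow> \<gamma> = \<alpha> * \<beta>"
    proof
      assume *: "\<forall>i<n. \<forall>j<n. fl_scale \<gamma> (fl_bracket (?b ! i) (?b ! j)) = fl_scale (\<alpha> * \<beta>) (fl_bracket (?b ! i) (?b ! j))"
      \<comment> \<open>The first two letters have a nonzero bracket, on which the scalars can be
        compared.\<close>
      have "0 < n" "1 < n" using two_letters by auto
      with * have "fl_scale \<gamma> (fl_bracket (?b ! 0) (?b ! 1)) = fl_scale (\<alpha> * \<beta>) (fl_bracket (?b ! 0) (?b ! 1))"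
        by blast
      then show "\<gamma> = \<alpha> * \<beta>"
        by (rule free_lie.scale_right_imp_eq[rotated]) (use two_letters in \<open>intro bracket_basis_neq_zero; simp\<close>)
    qed simp
    finally show "?Q (?s \<alpha> @ ?s \<beta> @ ?s \<gamma>) \<longleftrightarrow> \<gamma> = [\<alpha>, \<beta>] ! 0 * [\<alpha>, \<beta>] ! 1"
      by simp
  qed
  have "scalar ` scalars = (UNIV :: 'k set)"
    by (auto simp: image_image scalar_scalar_tuple)
  then show ?thesis
    unfolding e_interpretation_def field_functions_def
    using eq add mult e_definable_if_defined_by_system[OF defined_scalars] by simp
qed

text \<open>By \<open>scale_iff_brackets\<close> the action is given by equations in which the
  scalar enters only through its tuple; \<open>x\<close> sits at position \<open>n\<close> and
  \<open>z\<close> at \<open>Suc n\<close>.\<close>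

lemma defined_scalar_action:
  "defined_by_system fl_bracket UNIV (n + 2)
    {y @ [x, z] | y x z. y \<in> scalars \<and> z = fl_scale (scalar y :: 'k::field) x}"
proof -
  let ?b = "basis :: ('x, 'k) free_lie list"
  have "{y @ [x, z] | y x z. y \<in> scalars \<and> z = fl_scale (scalar y :: 'k) x} =
    {w. length w = n + 2 \<and> take n (drop 0 w) \<in> scalars \<and>
      (\<forall>i<n. fl_bracket (w ! Suc n) (?b ! i) = fl_bracket (w ! n) (w ! i))}" (is "?L = ?R")
  proof (intro subset_antisym subsetI)
    fix w assume "w \<in> ?L"
    then obtain y x \<alpha> where "w = y @ [x, fl_scale (scalar y) x]" "y = scalar_tuple fl_scale basis \<alpha>"
      by blast
    then obtain z where w: "w = scalar_tuple fl_scale basis \<alpha> @ [x, z]" "z = fl_scale \<alpha> x"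
      by (simp add: scalar_scalar_tuple)
    then show "w \<in> ?R" using scale_iff_brackets[of z \<alpha> x] by (auto simp: nth_append)
  next
    fix w assume w: "w \<in> ?R"
    then obtain \<alpha> where \<alpha>: "take n w = scalar_tuple fl_scale basis \<alpha>" by auto
    have "length (drop n w) = Suc (Suc 0)" using w by simp
    then obtain x z where "drop n w = [x, z]" unfolding length_Suc_conv by auto
    then have xz: "w = scalar_tuple fl_scale basis \<alpha> @ [x, z]" by (metis \<alpha> append_take_drop_id)
    have "z = fl_scale \<alpha> x" using w unfolding scale_iff_brackets by (auto simp: xz nth_append)
    then show "w \<in> ?L" using xz by (auto simp: scalar_scalar_tuple)
  qed
  moreover have "defined_by_system fl_bracket UNIV (n + 2)
      {w. length w = n + 2 \<and> fl_bracket (w ! Suc n) (?b ! i) = fl_bracket (w ! n) (w ! i)}" if "i < n" for i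
    using defined_by_system_eq[of "Br (Var (Suc n)) (Coeff (?b ! i))" "Br (Var n) (Var i)" UNIV "n + 2" fl_bracket] that
    by simp
  then have "defined_by_system fl_bracket UNIV (n + 2) ?R"
    by (intro defined_by_system_conj defined_by_system_all_less defined_scalars_block) auto
  ultimately show ?thesis by (simp only:)
qed

end

theorem theorem1:
  fixes n :: nat
    and xs :: "'x list"
    and a :: "('x, 'k::field) free_lie list"
    and A0 :: "('x, 'k) free_lie list set"
    and \<phi> :: "('x, 'k) free_lie list \<Rightarrow> 'k"
  assumes "n \<ge> 2"
    and "distinct xs" and "set xs = UNIV" and "length xs = n"
  defines "a \<equiv> map fl_gen xs"
    and "A0 \<equiv> range (scalar_tuple fl_scale a)"
    and "\<phi> \<equiv> scalar_of fl_scale a"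
  shows "defined_by_system fl_bracket (set a) n A0 \<and>
    (\<forall>\<alpha>. \<phi> (scalar_tuple fl_scale a \<alpha>) = \<alpha>) \<and>
    e_interpretation fl_bracket n A0 \<phi> (UNIV :: 'k set) field_functions {} \<and>
    defined_by_system fl_bracket UNIV (n + 2)
      {y @ [x, z] | y x z. y \<in> A0 \<and> z = fl_scale (\<phi> y) x} \<and>
    (\<forall>\<alpha> y x z. y = scalar_tuple fl_scale a \<alpha> \<longrightarrow>
      (z = fl_scale \<alpha> x \<longleftrightarrow> (\<forall>i<n. fl_bracket z (a ! i) = fl_bracket x (y ! i))))"
proof -
  interpret finite_basis xs n
    using assms(1-4) by unfold_locales
  show ?thesis
    unfolding a_def A0_def \<phi>_def
    using defined_scalars scalar_scalar_tuple e_interpretation_scalars defined_scalar_action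
      scale_iff_brackets by blast
qed

end
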